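(* Let $(A,\tau)$ be a locally convex topological algebra and let $L\colon A\to\mathbb{R}$ be a $\tau$-continuous $\sum A^2$-positive linear functional with $L(1)=1$. Let $B\subseteq A$ be a $\tau$-dense subalgebra generated by $\{b_i:i\in I\}$ such that $\sup_{d\in\mathbb{N}}p_d(b_i)<\infty$ for all $i\in I$ and $\tau_{L\restriction_B}\subseteq\tau\!\restriction_B$. Then there exists a unique representing Radon measure $\nu_L$ for $L$ with compact support. In particular, $$\operatorname{supp}(\nu_L)\subseteq\{\alpha\in X(A): |\alpha(b_i)|\le p_L(b_i)\text{ for all }i\in I\}.$$
   Context: $A$ is a unital commutative $\mathbb{R}$-algebra whose character space $X(A)$ (the set of all (unital) $\mathbb{R}$-algebra homomorphisms $A\to\mathbb{R}$) is non-empty; $X(A)$ carries the weakest topology making all $\hat a\colon X(A)\to\mathbb{R}$, $\hat a(\alpha)=\alpha(a)$, $a\in A$, continuous. A Radon measure on $X(A)$ is a non-negative Borel measure that is locally finite and inner regular w.r.t. compact sets; $\operatorname{supp}(\nu)$ is the smallest closed set with complement of $\nu$-measure zero; $\nu$ is representing for $L$ if $L(a)=\int\hat a\,\mathrm{d}\nu$ for all $a\in A$. $(A,\tau)$ is a locally convex topological algebra if $\tau$ is generated by a family of seminorms and multiplication is separately continuous (joint continuity is not assumed). $\sum A^2$-positive means $L(a^2)\ge0$ for all $a\in A$. $\mathbb{N}=\{1,2,\dots\}$; $p_d(a):=\sqrt[2^d]{L(a^{2^d})}$ for $d\in\mathbb{N}$; $p_L(a):=\sup_{n\in\mathbb{N}}\sqrt[2n]{L(a^{2n})}$.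 $\tau\!\restriction_B$ is the subspace topology on $B$, and $\tau_{L\restriction_B}$ is the topology on $B$ generated by the submultiplicative seminorm $p_{L\restriction_B}(b):=\sup_{n\in\mathbb{N}}\sqrt[2n]{L(b^{2n})}$, $b\in B$ (finite on $B$ under the stated hypotheses). *)

theory Defs
  imports "HOL-Analysis.Analysis"
begin

section \<open>Locally convex topological algebras\<close>

definition seminorm :: "('a::real_vector \<Rightarrow> real) \<Rightarrow> bool" where
  "seminorm p \<longleftrightarrow>
     (\<forall>x. 0 \<le> p x) \<and>
     (\<forall>x y. p (x + y) \<le> p x + p y) \<and>
     (\<forall>c x. p (c *\<^sub>R x) = \<bar>c\<bar> * p x)"

text \<open>
  The topology generated on a linear subspace \<open>S\<close> by a family \<open>P\<close> of functions that are
  seminorms on \<open>S\<close>. Inserting \<open>S\<close> into the subbase only matters for empty \<open>P\<close>, where the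
  topology is the indiscrete one.
\<close>
definition seminorm_topology :: "'a::real_vector set \<Rightarrow> ('a \<Rightarrow> real) set \<Rightarrow> 'a topology" where
  "seminorm_topology S P =
     topology_generated_by
       (insert S {{x \<in> S. p (x - a) < r} | p a r. p \<in> P \<and> a \<in> S \<and> 0 < r})"

text \<open>Neither the Hausdorff property nor joint continuity of multiplication is assumed.\<close>
definition locally_convex_algebra :: "'a::real_algebra topology \<Rightarrow> bool" where
  "locally_convex_algebra \<tau> \<longleftrightarrow>
     (\<exists>P. (\<forall>p\<in>P. seminorm p) \<and> \<tau> = seminorm_topology UNIV P) \<and>
     (\<forall>a. continuous_map \<tau> \<tau> (\<lambda>x. a * x) \<and> continuous_map \<tau> \<tau> (\<lambda>x. x * a))"

text \<open>Subalgebras of a unital algebra contain its unit.\<close>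
definition unital_subalgebra :: "'a::real_algebra_1 set \<Rightarrow> bool" where
  "unital_subalgebra B \<longleftrightarrow> subspace B \<and> 1 \<in> B \<and> (\<forall>x\<in>B. \<forall>y\<in>B. x * y \<in> B)"

section \<open>The character space and Radon measures on it\<close>

definition characters :: "('a::real_algebra_1 \<Rightarrow> real) set" where
  "characters = {\<alpha>. linear \<alpha> \<and> \<alpha> 1 = 1 \<and> (\<forall>x y. \<alpha> (x * y) = \<alpha> x * \<alpha> y)}"

definition character_topology :: "('a::real_algebra_1 \<Rightarrow> real) topology" where
  "character_topology =
     topology_generated_by {{\<alpha> \<in> characters. \<alpha> a \<in> U} | a U. open U}"

definition radon_measure :: "'x topology \<Rightarrow> 'x measure \<Rightarrow> bool" where
  "radon_measure T \<nu> \<longleftrightarrow>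
     sets \<nu> = sets (sigma (topspace T) {U. openin T U}) \<and>
     (\<forall>x\<in>topspace T. \<exists>U. openin T U \<and> x \<in> U \<and> emeasure \<nu> U < \<infinity>) \<and>
     (\<forall>E\<in>sets \<nu>. emeasure \<nu> E = (SUP K\<in>{K. compactin T K \<and> K \<subseteq> E}. emeasure \<nu> K))"

text \<open>The least element is taken with respect to inclusion; it exists for every Radon measure
  on a Hausdorff space, so in particular on the character space.\<close>
definition support :: "'x topology \<Rightarrow> 'x measure \<Rightarrow> 'x set" where
  "support T \<nu> = (LEAST C. closedin T C \<and> emeasure \<nu> (topspace T - C) = 0)"

definition represents :: "('a::real_algebra_1 \<Rightarrow> real) measure \<Rightarrow> ('a \<Rightarrow> real) \<Rightarrow> bool" where
  "represents \<nu> L \<longleftrightarrow> (\<forall>a. has_bochner_integral \<nu> (\<lambda>\<alpha>. \<alpha> a) (L a))"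

section \<open>The seminorms associated with a positive functional\<close>

definition p_dyadic :: "('a::real_algebra_1 \<Rightarrow> real) \<Rightarrow> nat \<Rightarrow> 'a \<Rightarrow> real" where
  "p_dyadic L d a = root (2 ^ d) (L (a ^ (2 ^ d)))"

text \<open>A real supremum, so it has its intended value only at those \<open>a\<close> where the set is bounded.\<close>
definition p_sup :: "('a::real_algebra_1 \<Rightarrow> real) \<Rightarrow> 'a \<Rightarrow> real" where
  "p_sup L a = (SUP n\<in>{1..}. root (2 * n) (L (a ^ (2 * n))))"

end

(*
  The elements a for which L(a^2 c^2) <= K L(c^2) for all c form a subalgebra. It contains the b_i,
  hence B, and since p_L is continuous on the dense subalgebra B it is all of A: on a neighbourhood
  of 0 the estimate passes to the limit in the separately continuous expression L(x a c^2), with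
  Cauchy-Schwarz. So L belongs to a pointwise compact set S of normalised positive functionals
  satisfying the same estimates, and the extreme points of S are characters. Minimising
  f(a) over f in S (Krein-Milman) shows that L(a) >= 0 whenever the transform of a is nonnegative on
  the compact set of characters in S. By Stone-Weierstrass L extends to a positive functional on the
  continuous functions there, which the Riesz representation theorem turns into a measure.
  Uniqueness is Stone-Weierstrass on the union of two supports, and the bound on the support is
  Markov's inequality for the moments L(b_i^(2n)).
*)
theory Submission
  imports Defs
begin

section \<open>The Riesz representation theorem on a compact Hausdorff space\<close>

text \<open>The inequality L(a^2 c^2) <= K L(c^2) says that multiplication by a is bounded for the
  semi-inner product L(xy). The factor c^2 is carried along because a bound on L(a^2) alone would
  not pass to products. Such a bound improves itself: by iterated Cauchy-Schwarz, an estimate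
  L(a^(2m) c^2) <= D K^m for m = 2^k already gives the case m = 1 with L(c^2) in place of D, however
  large D is. This turns the moment bounds on the b_i into operator bounds, sharpens an arbitrary
  constant K to p_L(x)^2, and keeps both parts of the convex decomposition of a state within the
  same constants. The last point is what makes extreme points multiplicative: the constants K(a)
  have to be shared by all functionals in S, since they give compactness, yet a difference of
  functionals does not visibly inherit them. The other obstacle is that L(x^2) need not be
  continuous in x when multiplication is only separately continuous, so density has to act on one
  factor at a time.\<close>

lemma openin_Pow: "{U. openin T U} \<subseteq> Pow (topspace T)"
  using openin_subset by blast

text \<open>The k-th summand is the length of the part of [0, y] that lies in [k/N, (k+1)/N].
  Applied pointwise, this cuts a function into horizontal slices.\<close>

lemma sum_slices:
  fixes y :: real and n :: nat
  assumes "0 \<le> y" "y \<le> real n / N" "0 < N"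
  shows "(\<Sum>k<n. min (max (y - real k / N) 0) (1 / N)) = y"
  using assms(1,2)
proof (induction n)
  case (Suc n)
  show ?case
  proof (cases "y \<le> n / N")
    case True
    then show ?thesis using Suc assms(3) by simp
  next
    case False
    have "min (max (y - real k / N) 0) (1 / N) = 1 / N" if "k < n" for k
    proof -
      have "real k + 1 \<le> real n" using that by simp
      then have "(real k + 1) / N \<le> real n / N" using assms(3) by (simp add: divide_right_mono)
      then have "1 / N \<le> y - k / N" using False by (simp add: add_divide_distrib)
      moreover have "0 < 1 / N" using assms(3) by simp
      ultimately show ?thesis by linarith
    qed
    then have "(\<Sum>k<n. min (max (y - real k / N) 0) (1 / N)) = n / N" by simp
    moreover have "y - n / N \<le> 1 / N" using Suc.prems(2) by (simp add: add_divide_distrib)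
    ultimately show ?thesis using False by (simp add: min_def max_def)
  qed
qed simp

lemma sum_indicator_le:
  fixes y :: real and n :: nat
  assumes "0 \<le> y" "0 < N"
  shows "(\<Sum>k<n. if real k / N < y then 1 / N else 0) \<le> y + 1 / N"
proof -
  \<comment> \<open>The bound \<open>n / N\<close> strengthens the induction: a new summand is added
    only when n/N < y, and then n/N + 1/N is below y + 1/N.\<close>
  have "(\<Sum>k<n. if real k / N < y then 1 / N else 0) \<le> min (real n / N) (y + 1 / N)"
  proof (induction n)
    case 0
    then show ?case using assms by simp
  next
    case (Suc n)
    then show ?case using assms by (auto simp: min_def add_divide_distrib split: if_splits)
  qed
  then show ?thesis by simp
qed

lemma Urysohn_unit_interval:
  assumes "compact_space X" "Hausdorff_space X"
    and "closedin X S" "closedin X T" "S \<inter> T = {}"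
  obtains g where "continuous_map X euclideanreal g"
    "\<And>x. x \<in> topspace X \<Longrightarrow> 0 \<le> g x \<and> g x \<le> 1"
    "\<And>x. x \<in> S \<Longrightarrow> g x = 0" "\<And>x. x \<in> T \<Longrightarrow> g x = 1"
proof -
  have "normal_space X"
    using assms compact_Hausdorff_or_regular_imp_normal_space by blast
  then obtain g where g: "continuous_map X (top_of_set {0..1::real}) g" "g ` S \<subseteq> {0}" "g ` T \<subseteq> {1}"
    using Urysohn_lemma[of X S T 0 1] assms by (auto simp: disjnt_def)
  show thesis
    by (rule that[of g]) (use g in \<open>auto simp: continuous_map_in_subtopology image_subset_iff Pi_iff\<close>)
qed

text \<open>The axioms constrain \<Lambda> at continuous functions only, and by \<open>mono\<close>
  its value there depends only on the values of the function on \<open>topspace X\<close>. Nothing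
  normalises \<Lambda>: the total mass \<open>\<Lambda> (\<lambda>x. 1)\<close> may be 0.\<close>

locale positive_functional =
  fixes X :: "'x topology" and \<Lambda> :: "('x \<Rightarrow> real) \<Rightarrow> real"
  assumes compact: "compact_space X" and Hausdorff: "Hausdorff_space X"
    and add: "\<And>f g. continuous_map X euclideanreal f \<Longrightarrow> continuous_map X euclideanreal g \<Longrightarrow>
                 \<Lambda> (\<lambda>x. f x + g x) = \<Lambda> f + \<Lambda> g"
    and scale: "\<And>f c. continuous_map X euclideanreal f \<Longrightarrow> \<Lambda> (\<lambda>x. c * f x) = c * \<Lambda> f"
    and nonneg: "\<And>f. continuous_map X euclideanreal f \<Longrightarrow>
                 (\<And>x. x \<in> topspace X \<Longrightarrow> 0 \<le> f x) \<Longrightarrow> 0 \<le> \<Lambda> f"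
begin

section \<open>The content of open sets defined by a positive functional\<close>

lemma mono:
  assumes "continuous_map X euclideanreal f" "continuous_map X euclideanreal g"
    and "\<And>x. x \<in> topspace X \<Longrightarrow> f x \<le> g x"
  shows "\<Lambda> f \<le> \<Lambda> g"
proof -
  have c: "continuous_map X euclideanreal (\<lambda>x. (-1) * f x)"
    using assms(1) by (intro continuous_intros) auto
  have "0 \<le> \<Lambda> (\<lambda>x. g x + (-1) * f x)"
    by (rule nonneg) (use assms c in \<open>auto intro!: continuous_intros\<close>)
  also have "\<dots> = \<Lambda> g + (-1) * \<Lambda> f"
    by (simp only: add[OF assms(2) c] scale[OF assms(1)])
  finally show ?thesis by simp
qed

lemma zero: "\<Lambda> (\<lambda>x. 0) = 0"
  using scale[of "\<lambda>x. 0" 0] by simp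

lemma one_nonneg: "0 \<le> \<Lambda> (\<lambda>x. 1)"
  by (rule nonneg) auto

text \<open>The functions only have to vanish off U; their supports need not lie in U. Where a
  closed set inside U is wanted, f is replaced by max 0 (f - e), which vanishes off the closed set
  where f >= e.\<close>

definition under :: "'x set \<Rightarrow> ('x \<Rightarrow> real) set" where
  "under U = {f. continuous_map X euclideanreal f \<and> (\<forall>x\<in>topspace X. 0 \<le> f x \<and> f x \<le> 1) \<and>
                 (\<forall>x\<in>topspace X - U. f x = 0)}"

definition inner_content :: "'x set \<Rightarrow> real" where
  "inner_content U = (SUP f\<in>under U. \<Lambda> f)"

lemma zero_under: "(\<lambda>x. 0) \<in> under U"
  by (simp add: under_def)

lemma under_le_one: "f \<in> under U \<Longrightarrow> \<Lambda> f \<le> \<Lambda> (\<lambda>x. 1)"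
  by (rule mono) (auto simp: under_def)

lemma inner_content_upper: "f \<in> under U \<Longrightarrow> \<Lambda> f \<le> inner_content U"
  unfolding inner_content_def
  by (rule cSUP_upper) (auto intro!: bdd_aboveI2[where M = "\<Lambda> (\<lambda>x. 1)"] under_le_one)

lemma inner_content_least: "(\<And>f. f \<in> under U \<Longrightarrow> \<Lambda> f \<le> c) \<Longrightarrow> inner_content U \<le> c"
  unfolding inner_content_def by (rule cSUP_least) (use zero_under in auto)

lemma inner_content_nonneg: "0 \<le> inner_content U"
  using inner_content_upper[OF zero_under] zero by simp

lemma inner_content_mono: "U \<subseteq> V \<Longrightarrow> inner_content U \<le> inner_content V"
  by (rule inner_content_least, rule inner_content_upper) (auto simp: under_def)

lemma inner_content_empty: "inner_content {} = 0"
proof (rule antisym[OF inner_content_least inner_content_nonneg])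
  fix f assume f: "f \<in> under {}"
  then have "\<Lambda> f \<le> \<Lambda> (\<lambda>x. 0)"
    by (intro mono) (auto simp: under_def)
  then show "\<Lambda> f \<le> 0" by (simp add: zero)
qed

lemma inner_content_topspace: "inner_content (topspace X) = \<Lambda> (\<lambda>x. 1)"
proof (rule antisym)
  show "inner_content (topspace X) \<le> \<Lambda> (\<lambda>x. 1)"
    by (rule inner_content_least, rule under_le_one)
  show "\<Lambda> (\<lambda>x. 1) \<le> inner_content (topspace X)"
    by (rule inner_content_upper) (auto simp: under_def)
qed

lemma le_by_eps:
  assumes "\<And>e. 0 < e \<Longrightarrow> a \<le> b + e * \<Lambda> (\<lambda>x. 1)"
  shows "a \<le> b"
proof (rule field_le_epsilon)
  fix d :: real assume "0 < d"
  \<comment> \<open>Adding 1 keeps the denominator positive when the total mass is 0.\<close>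
  have p: "0 < \<Lambda> (\<lambda>x. 1) + 1" using one_nonneg by linarith
  have "a \<le> b + d / (\<Lambda> (\<lambda>x. 1) + 1) * \<Lambda> (\<lambda>x. 1)"
    by (rule assms) (use \<open>0 < d\<close> p in simp)
  also have "d / (\<Lambda> (\<lambda>x. 1) + 1) * \<Lambda> (\<lambda>x. 1) \<le> d"
    using \<open>0 < d\<close> p by (simp add: field_simps)
  finally show "a \<le> b + d" by simp
qed

lemma functional_le_truncation:
  assumes f: "continuous_map X euclideanreal f"
  shows "continuous_map X euclideanreal (\<lambda>x. max 0 (f x - e))"
    and "\<Lambda> f \<le> \<Lambda> (\<lambda>x. max 0 (f x - e)) + e * \<Lambda> (\<lambda>x. 1)"
proof -
  let ?g = "\<lambda>x. max 0 (f x - e)"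
  show g: "continuous_map X euclideanreal ?g"
    using f by (intro continuous_intros) auto
  have "\<Lambda> f \<le> \<Lambda> (\<lambda>x. ?g x + e * 1)"
    by (rule mono) (use f g in \<open>auto intro!: continuous_intros\<close>)
  also have "\<dots> = \<Lambda> ?g + e * \<Lambda> (\<lambda>x. 1)"
    using add[OF g, of "\<lambda>x. e * 1"] scale[of "\<lambda>x. 1" e] by simp
  finally show "\<Lambda> f \<le> \<Lambda> ?g + e * \<Lambda> (\<lambda>x. 1)" .
qed

text \<open>The truncation max 0 (f - e) belongs to \<open>under U\<close> and costs at most e times
  the total mass. This is the form in which functions that are small, but not zero, off U are
  compared with the content of U.\<close>

lemma le_inner_content:
  assumes f: "continuous_map X euclideanreal f" "\<And>x. x \<in> topspace X \<Longrightarrow> f x \<le> 1"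
    and e: "0 \<le> e" and U: "\<And>x. x \<in> topspace X \<Longrightarrow> e < f x \<Longrightarrow> x \<in> U"
  shows "\<Lambda> f \<le> inner_content U + e * \<Lambda> (\<lambda>x. 1)"
proof -
  let ?g = "\<lambda>x. max 0 (f x - e)"
  note g = functional_le_truncation[OF f(1), of e]
  have "?g \<in> under U"
    using f(2) e U g(1) unfolding under_def by (force simp: max_def)
  then have "\<Lambda> ?g \<le> inner_content U" by (rule inner_content_upper)
  with g(2) show ?thesis by linarith
qed

lemma closedin_ge: "continuous_map X euclideanreal f \<Longrightarrow> closedin X {x \<in> topspace X. e \<le> f x}"
  using closedin_continuous_map_preimage[of X euclideanreal f "{e..}"] by simp

lemma openin_gt: "continuous_map X euclideanreal f \<Longrightarrow> openin X {x \<in> topspace X. e < f x}"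
  using openin_continuous_map_preimage[of X euclideanreal f "{e<..}"] by simp

lemma inner_content_Un:
  assumes U: "openin X U" and V: "openin X V"
  shows "inner_content (U \<union> V) \<le> inner_content U + inner_content V"
proof (rule inner_content_least, rule le_by_eps)
  fix f and e :: real assume f: "f \<in> under (U \<union> V)" and e: "0 < e"
  have fc: "continuous_map X euclideanreal f" using f by (simp add: under_def)
  have f01: "\<And>x. x \<in> topspace X \<Longrightarrow> 0 \<le> f x \<and> f x \<le> 1" using f by (simp add: under_def)
  have f0: "\<And>x. x \<in> topspace X \<Longrightarrow> x \<notin> U \<Longrightarrow> x \<notin> V \<Longrightarrow> f x = 0" using f by (simp add: under_def)
  \<comment> \<open>A two-piece partition of f: f g lives in U because g vanishes off U, and f (1 -
    g) exceeds e only in V because g = 1 wherever f >= e off V. The two closed sets are disjoint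
    since f vanishes off the union of U and V.\<close>
  obtain g where g: "continuous_map X euclideanreal g"
    "\<And>x. x \<in> topspace X \<Longrightarrow> 0 \<le> g x \<and> g x \<le> 1"
    "\<And>x. x \<in> topspace X - U \<Longrightarrow> g x = 0"
    "\<And>x. x \<in> {x \<in> topspace X. e \<le> f x} - V \<Longrightarrow> g x = 1"
  proof (rule Urysohn_unit_interval[OF compact Hausdorff, of "topspace X - U" "{x \<in> topspace X. e \<le> f x} - V"])
    show "closedin X (topspace X - U)" using U by blast
    show "closedin X ({x \<in> topspace X. e \<le> f x} - V)"
      using closedin_ge[OF fc] V by (rule closedin_diff)
    show "(topspace X - U) \<inter> ({x \<in> topspace X. e \<le> f x} - V) = {}"
      using f0 e by force
  qed blast
  have c1: "continuous_map X euclideanreal (\<lambda>x. f x * g x)"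
    and c2: "continuous_map X euclideanreal (\<lambda>x. f x * (1 - g x))"
    using fc g(1) by (auto intro!: continuous_intros)
  have "(\<lambda>x. f x * g x) \<in> under U"
    using c1 f01 g(2,3) by (auto simp: under_def intro: mult_le_one)
  then have "\<Lambda> (\<lambda>x. f x * g x) \<le> inner_content U" by (rule inner_content_upper)
  moreover have "\<Lambda> (\<lambda>x. f x * (1 - g x)) \<le> inner_content V + e * \<Lambda> (\<lambda>x. 1)"
  proof (rule le_inner_content[OF c2])
    fix x assume x: "x \<in> topspace X"
    have le: "f x * (1 - g x) \<le> f x"
      using f01[OF x] g(2)[OF x] by (intro mult_left_le) auto
    then show "f x * (1 - g x) \<le> 1" using f01[OF x] by linarith
    show "x \<in> V" if "e < f x * (1 - g x)"
    proof (rule ccontr)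
      assume "x \<notin> V"
      moreover have "e \<le> f x" using that le by linarith
      ultimately have "g x = 1" using g(4) x by blast
      with that e show False by simp
    qed
  qed (use e in simp)
  moreover have "\<Lambda> f = \<Lambda> (\<lambda>x. f x * g x) + \<Lambda> (\<lambda>x. f x * (1 - g x))"
    using add[OF c1 c2] by (simp add: algebra_simps)
  ultimately show "\<Lambda> f \<le> inner_content U + inner_content V + e * \<Lambda> (\<lambda>x. 1)" by linarith
qed

lemma inner_content_UN_finite:
  fixes n :: nat
  assumes "\<And>i. openin X (U i)"
  shows "inner_content (\<Union>i<n. U i) \<le> (\<Sum>i<n. inner_content (U i))"
proof (induction n)
  case (Suc n)
  have "inner_content (\<Union>i<Suc n. U i) \<le> inner_content (\<Union>i<n. U i) + inner_content (U n)"
    using inner_content_Un[of "\<Union>i<n. U i" "U n"] assms by (auto simp: lessThan_Suc Un_commute)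
  with Suc show ?case by simp
qed (simp add: inner_content_empty)

text \<open>The set where f >= e is compact, so finitely many of the U i cover it and finite
  subadditivity applies. The extended reals absorb the case of a divergent series.\<close>

lemma inner_content_UN:
  assumes U: "\<And>i::nat. openin X (U i)"
  shows "ennreal (inner_content (\<Union>i. U i)) \<le> (\<Sum>i. ennreal (inner_content (U i)))"
proof (cases "(\<Sum>i. ennreal (inner_content (U i)))")
  case (real s)
  have "inner_content (\<Union>i. U i) \<le> s"
  proof (rule inner_content_least, rule le_by_eps)
    fix f and e :: real assume f: "f \<in> under (\<Union>i. U i)" and e: "0 < e"
    have fc: "continuous_map X euclideanreal f" using f by (simp add: under_def)
    have "compactin X {x \<in> topspace X. e \<le> f x}"
      using closedin_compact_space[OF compact closedin_ge[OF fc]] .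
    moreover have "{x \<in> topspace X. e \<le> f x} \<subseteq> \<Union>(range U)"
      using f e by (force simp: under_def)
    ultimately obtain \<F> where \<F>: "finite \<F>" "\<F> \<subseteq> range U" "{x \<in> topspace X. e \<le> f x} \<subseteq> \<Union>\<F>"
      using U by (smt (verit, best) compactinD imageE)
    then obtain J where J: "finite J" "\<F> = U ` J" by (meson finite_subset_image)
    then obtain n where n: "J \<subseteq> {..<n}" using finite_nat_iff_bounded by blast
    have "\<Lambda> f \<le> inner_content (\<Union>i<n. U i) + e * \<Lambda> (\<lambda>x. 1)"
    proof (rule le_inner_content[OF fc])
      fix x assume x: "x \<in> topspace X"
      show "f x \<le> 1" using x f by (simp add: under_def)
      show "x \<in> (\<Union>i<n. U i)" if "e < f x"
      proof -
        have "x \<in> \<Union>\<F>" using \<F>(3) x that by auto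
        then show ?thesis using J n by auto
      qed
    qed (use e in simp)
    also have "inner_content (\<Union>i<n. U i) \<le> (\<Sum>i<n. inner_content (U i))"
      by (rule inner_content_UN_finite[OF U])
    also have "\<dots> \<le> s"
    proof -
      have "ennreal (\<Sum>i<n. inner_content (U i)) = (\<Sum>i<n. ennreal (inner_content (U i)))"
        by (simp add: inner_content_nonneg)
      also have "\<dots> \<le> (\<Sum>i. ennreal (inner_content (U i)))"
        by (rule sum_le_suminf) auto
      finally show ?thesis using real by simp
    qed
    finally show "\<Lambda> f \<le> s + e * \<Lambda> (\<lambda>x. 1)" by simp
  qed
  then show ?thesis using real by simp
qed simp

section \<open>The outer measure and the Caratheodory construction\<close>

definition outer :: "'x set \<Rightarrow> ennreal" where
  "outer E = (INF U\<in>{U. openin X U \<and> E \<subseteq> U}. ennreal (inner_content U))"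

lemma outer_le: "openin X U \<Longrightarrow> E \<subseteq> U \<Longrightarrow> outer E \<le> ennreal (inner_content U)"
  unfolding outer_def by (rule INF_lower) simp

lemma outer_mono: "E \<subseteq> F \<Longrightarrow> outer E \<le> outer F"
  unfolding outer_def by (rule INF_superset_mono) auto

lemma outer_open: "openin X U \<Longrightarrow> outer U = ennreal (inner_content U)"
  by (rule antisym[OF outer_le]) (auto simp: outer_def intro!: INF_greatest ennreal_leI inner_content_mono)

lemma outer_finite: "E \<subseteq> topspace X \<Longrightarrow> outer E < \<infinity>"
  using outer_le[of "topspace X" E] by (auto simp: top.not_eq_extremum order_le_less_trans)

lemma outer_approx:
  assumes "E \<subseteq> topspace X" "0 < e"
  obtains U where "openin X U" "E \<subseteq> U" "ennreal (inner_content U) \<le> outer E + ennreal e"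
proof -
  have "outer E < outer E + ennreal e"
    using assms outer_finite[of E] by (simp add: ennreal_add_left_cancel_less)
  then show thesis
    using that unfolding outer_def INF_less_iff by (auto simp: less_imp_le)
qed

lemma outer_measure_space_outer: "outer_measure_space (Pow (topspace X)) outer"
  unfolding outer_measure_space_def
proof (intro conjI)
  show "positive (Pow (topspace X)) outer"
    using outer_open[of "{}"] by (simp add: positive_def inner_content_empty)
  show "increasing (Pow (topspace X)) outer"
    by (simp add: increasing_def outer_mono)
  show "countably_subadditive (Pow (topspace X)) outer"
    unfolding countably_subadditive_def
  proof safe
    fix A :: "nat \<Rightarrow> 'x set" assume A: "range A \<subseteq> Pow (topspace X)"
    show "outer (\<Union>i. A i) \<le> (\<Sum>i. outer (A i))"
    proof (rule ennreal_le_epsilon)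
      fix e :: real assume e: "0 < e"
      have "\<exists>U. openin X U \<and> A i \<subseteq> U \<and>
          ennreal (inner_content U) \<le> outer (A i) + ennreal (e * (1/2) ^ Suc i)" for i
        using outer_approx[of "A i" "e * (1/2) ^ Suc i"] A e by (metis PowD half_gt_zero_iff mult_pos_pos
            rangeI subset_iff zero_less_one zero_less_power)
      then obtain U where U: "\<And>i. openin X (U i)" "\<And>i. A i \<subseteq> U i"
        "\<And>i. ennreal (inner_content (U i)) \<le> outer (A i) + ennreal (e * (1/2) ^ Suc i)"
        by metis
      have "outer (\<Union>i. A i) \<le> ennreal (inner_content (\<Union>i. U i))"
        using U by (intro outer_le) (auto intro!: openin_Union)
      also have "\<dots> \<le> (\<Sum>i. ennreal (inner_content (U i)))"
        by (rule inner_content_UN[OF U(1)])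
      also have "\<dots> \<le> (\<Sum>i. outer (A i) + ennreal (e * (1/2) ^ Suc i))"
        by (intro suminf_le U) auto
      also have "\<dots> = (\<Sum>i. outer (A i)) + (\<Sum>i. ennreal e * ennreal ((1/2) ^ Suc i))"
        using e by (subst suminf_add[symmetric])
          (auto simp del: ennreal_suminf_cmult simp add: ennreal_mult[symmetric])
      also have "\<dots> = (\<Sum>i. outer (A i)) + ennreal e"
        unfolding ennreal_suminf_cmult
        by (subst suminf_ennreal_eq[OF zero_le_power power_half_series]) auto
      finally show "outer (\<Union>i. A i) \<le> (\<Sum>i. outer (A i)) + ennreal e" .
    qed
  qed
qed

text \<open>Let f be admissible for the intersection of W and U, and C the closed set where f >= e.
  The open set W - C contains W - U, and a function h admissible for W - C vanishes on C, where the
  truncation of f lives. Hence their sum is still at most 1 and admissible for W, so the two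
  contents add up.\<close>

lemma outer_split_open:
  assumes U: "openin X U" and W: "openin X W"
  shows "ennreal (inner_content (W \<inter> U)) + outer (W - U) \<le> ennreal (inner_content W)"
proof -
  have WX: "W - U \<subseteq> topspace X" using openin_subset[OF W] by blast
  obtain r where r: "0 \<le> r" "outer (W - U) = ennreal r"
    using outer_finite[OF WX] by (cases "outer (W - U)") auto
  have "inner_content (W \<inter> U) \<le> inner_content W - r"
  proof (rule inner_content_least, rule le_by_eps)
    fix f and e :: real assume f: "f \<in> under (W \<inter> U)" and e: "0 < e"
    have fc: "continuous_map X euclideanreal f" using f by (simp add: under_def)
    let ?C = "{x \<in> topspace X. e \<le> f x}"
    let ?g = "\<lambda>x. max 0 (f x - e)"
    note gc = functional_le_truncation(1)[OF fc, of e]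
    have opC: "openin X (W - ?C)" using W closedin_ge[OF fc] by (rule openin_diff)
    have "W - U \<subseteq> W - ?C" using f e by (force simp: under_def)
    then have "r \<le> inner_content (W - ?C)"
      using outer_le[OF opC, of "W - U"] r by (simp add: inner_content_nonneg)
    also have "\<dots> \<le> inner_content W - \<Lambda> ?g"
    proof (rule inner_content_least)
      fix h assume h: "h \<in> under (W - ?C)"
      have hc: "continuous_map X euclideanreal h" using h by (simp add: under_def)
      have "(\<lambda>x. ?g x + h x) \<in> under W"
        unfolding under_def
      proof (intro CollectI conjI ballI)
        show "continuous_map X euclideanreal (\<lambda>x. ?g x + h x)"
          using gc hc by (rule continuous_map_add)
        fix x assume x: "x \<in> topspace X"
        have fx: "0 \<le> f x" "f x \<le> 1" using x f by (auto simp: under_def)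
        have hx: "0 \<le> h x" "h x \<le> 1" using x h by (auto simp: under_def)
        show "0 \<le> ?g x + h x" using hx by simp
        show "?g x + h x \<le> 1"
        proof (cases "e \<le> f x")
          case True
          then have "h x = 0" using h x by (auto simp: under_def)
          then show ?thesis using fx e by (simp add: max_def)
        qed (use hx in \<open>simp add: max_def\<close>)
      next
        fix x assume x: "x \<in> topspace X - W"
        then have "f x = 0" "h x = 0" using f h by (auto simp: under_def)
        then show "?g x + h x = 0" using e by simp
      qed
      from inner_content_upper[OF this] show "\<Lambda> h \<le> inner_content W - \<Lambda> ?g"
        using add[OF gc hc] by simp
    qed
    finally have "\<Lambda> ?g \<le> inner_content W - r" by simp
    with functional_le_truncation(2)[OF fc, of e] show "\<Lambda> f \<le> inner_content W - r + e * \<Lambda> (\<lambda>x. 1)" by linarith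
  qed
  then have "inner_content (W \<inter> U) + r \<le> inner_content W" by simp
  then show ?thesis
    using r by (simp add: inner_content_nonneg flip: ennreal_plus)
qed

abbreviation Borel :: "'x measure" where
  "Borel \<equiv> sigma (topspace X) {U. openin X U}"

lemma sets_Borel: "sets Borel = sigma_sets (topspace X) {U. openin X U}"
  by (rule sets_measure_of[OF openin_Pow])

text \<open>The splitting inequality is known for open test sets; an arbitrary E is enclosed in an
  open W of almost the same outer measure.\<close>

lemma open_in_lambda_system:
  assumes U: "openin X U"
  shows "U \<in> lambda_system (topspace X) (Pow (topspace X)) outer"
proof -
  interpret sigma_algebra "topspace X" "Pow (topspace X)" by (rule sigma_algebra_Pow)
  have "outer (E \<inter> U) + outer (E - U) = outer E" if E: "E \<subseteq> topspace X" for E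
  proof (rule antisym)
    show "outer (E \<inter> U) + outer (E - U) \<le> outer E"
    proof (rule ennreal_le_epsilon)
      fix e :: real assume "0 < e"
      then obtain W where W: "openin X W" "E \<subseteq> W" "ennreal (inner_content W) \<le> outer E + ennreal e"
        using outer_approx[OF E] by blast
      have "outer (E \<inter> U) + outer (E - U) \<le> ennreal (inner_content (W \<inter> U)) + outer (W - U)"
        using W U by (intro add_mono outer_le outer_mono) auto
      also have "\<dots> \<le> ennreal (inner_content W)" by (rule outer_split_open[OF U W(1)])
      finally show "outer (E \<inter> U) + outer (E - U) \<le> outer E + ennreal e" using W(3) by simp
    qed
    have "subadditive (Pow (topspace X)) outer"
      using outer_measure_space_outer countably_subadditive_subadditive
      by (auto simp: outer_measure_space_def)
    then have "outer ((E \<inter> U) \<union> (E - U)) \<le> outer (E \<inter> U) + outer (E - U)"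
      using E subadditiveD[of "Pow (topspace X)" outer "E \<inter> U" "E - U"] by blast
    moreover have "(E \<inter> U) \<union> (E - U) = E" by blast
    ultimately show "outer E \<le> outer (E \<inter> U) + outer (E - U)" by simp
  qed
  then show ?thesis
    using openin_subset[OF U] by (simp add: lambda_system_eq)
qed

definition riesz :: "'x measure" where
  "riesz = measure_of (topspace X) {U. openin X U} outer"

lemma sets_riesz: "sets riesz = sets Borel"
  by (simp add: riesz_def sets_measure_of[OF openin_Pow])

lemma space_riesz [simp]: "space riesz = topspace X"
  by (simp add: riesz_def space_measure_of[OF openin_Pow])

lemma emeasure_riesz:
  assumes "E \<in> sets riesz"
  shows "emeasure riesz E = outer E"
proof -
  let ?L = "lambda_system (topspace X) (Pow (topspace X)) outer"
  interpret sigma_algebra "topspace X" "Pow (topspace X)" by (rule sigma_algebra_Pow)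
  have ms: "measure_space (topspace X) ?L outer"
    by (rule caratheodory_lemma[OF outer_measure_space_outer])
  then have sa: "sigma_algebra (topspace X) ?L" by (simp add: measure_space_def)
  have sub: "sigma_sets (topspace X) {U. openin X U} \<subseteq> ?L"
    by (rule sigma_algebra.sigma_sets_subset[OF sa]) (auto intro: open_in_lambda_system)
  have "measure_space (topspace X) (sigma_sets (topspace X) {U. openin X U}) outer"
    by (rule measure_down[OF ms sigma_algebra_sigma_sets[OF openin_Pow] sub])
  then show ?thesis
    using assms unfolding riesz_def
    by (intro emeasure_measure_of[OF refl openin_Pow])
       (auto simp: measure_space_def sets_measure_of[OF openin_Pow])
qed

lemma openin_sets_riesz: "openin X U \<Longrightarrow> U \<in> sets riesz"
  by (simp add: sets_riesz sets_Borel)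

lemma emeasure_riesz_open: "openin X U \<Longrightarrow> emeasure riesz U = ennreal (inner_content U)"
  by (simp add: emeasure_riesz openin_sets_riesz outer_open)

lemma finite_measure_riesz: "finite_measure riesz"
  by (rule finite_measureI) (simp add: emeasure_riesz_open)

lemma measure_riesz_open: "openin X U \<Longrightarrow> measure riesz U = inner_content U"
  by (simp add: measure_def emeasure_riesz_open inner_content_nonneg)

text \<open>Outer regularity of the complement, read through complements; finiteness of the measure
  allows the subtraction.\<close>

lemma riesz_inner_approx:
  assumes E: "E \<in> sets riesz" and e: "0 < e"
  obtains C where "closedin X C" "C \<subseteq> E" "emeasure riesz E \<le> emeasure riesz C + ennreal e"
proof -
  interpret finite_measure riesz by (rule finite_measure_riesz)
  have EX: "E \<subseteq> topspace X" using sets.sets_into_space[OF E] by simp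
  obtain U where U: "openin X U" "topspace X - E \<subseteq> U"
    "ennreal (inner_content U) \<le> outer (topspace X - E) + ennreal e"
    using outer_approx[of "topspace X - E" e] e by auto
  have E': "topspace X - E \<in> sets riesz" using sets.compl_sets[OF E] by simp
  have "ennreal (measure riesz U) \<le> ennreal (measure riesz (topspace X - E)) + ennreal e"
    using U(3) emeasure_riesz[OF E'] measure_riesz_open[OF U(1)]
    by (simp add: emeasure_eq_measure)
  then have "measure riesz U \<le> measure riesz (topspace X - E) + e"
    using e by (simp flip: ennreal_plus)
  moreover have "measure riesz (topspace X - E) = measure riesz (topspace X) - measure riesz E"
    using finite_measure_compl[OF E] by simp
  moreover have "measure riesz (topspace X - U) = measure riesz (topspace X) - measure riesz U"
    using finite_measure_compl[OF openin_sets_riesz[OF U(1)]] by simp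
  ultimately have "measure riesz E \<le> measure riesz (topspace X - U) + e" by linarith
  then have "emeasure riesz E \<le> emeasure riesz (topspace X - U) + ennreal e"
    using e by (simp add: emeasure_eq_measure flip: ennreal_plus)
  then show thesis
    using that[of "topspace X - U"] U EX by blast
qed

section \<open>Integration against the constructed measure\<close>

lemma continuous_measurable_riesz:
  assumes "continuous_map X euclideanreal f"
  shows "f \<in> borel_measurable riesz"
  unfolding borel_measurable_iff_greater
  using openin_sets_riesz[OF openin_gt[OF assms]] by simp

lemma integrable_riesz:
  assumes "continuous_map X euclideanreal f" "\<And>x. x \<in> topspace X \<Longrightarrow> \<bar>f x\<bar> \<le> c"
  shows "integrable riesz f"
proof (rule finite_measure.integrable_const_bound[OF finite_measure_riesz])
  show "AE x in riesz. norm (f x) \<le> c"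
    by (rule AE_I2) (use assms(2) in simp)
qed (rule continuous_measurable_riesz[OF assms(1)])

text \<open>Cut f into n slices of height 1/n. The k-th slice times n is admissible for the open set
  where f > k/n, so its value under \<Lambda> is at most 1/n times the measure of that set. The
  indicators of these sets, divided by n, sum to at most f + 1/n.\<close>

lemma functional_le_integral:
  assumes fc: "continuous_map X euclideanreal f"
    and f01: "\<And>x. x \<in> topspace X \<Longrightarrow> 0 \<le> f x \<and> f x \<le> 1"
  shows "\<Lambda> f \<le> integral\<^sup>L riesz f"
proof (rule le_by_eps)
  fix e :: real assume "0 < e"
  then obtain n where n: "0 < n" "1 / real n < e"
    by (metis nat_approx_posE of_nat_0_less_iff zero_less_Suc)
  interpret finite_measure riesz by (rule finite_measure_riesz)
  let ?s = "\<lambda>k x. min (max (f x - real k / real n) 0) (1 / real n)"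
  let ?U = "\<lambda>k. {x \<in> topspace X. real k / real n < f x}"
  have sc: "continuous_map X euclideanreal (?s k)" for k
    using fc by (intro continuous_intros) auto
  have Ui: "integrable riesz (indicator (?U k) :: 'x \<Rightarrow> real)" for k
    using openin_sets_riesz[OF openin_gt[OF fc]] by (intro integrable_real_indicator) (auto simp: less_top[symmetric])
  have "\<Lambda> f \<le> \<Lambda> (\<lambda>x. \<Sum>k<n. ?s k x)"
  proof (rule mono[OF fc])
    show "continuous_map X euclideanreal (\<lambda>x. \<Sum>k<n. ?s k x)"
      using sc by (intro continuous_map_sum) auto
    fix x assume "x \<in> topspace X"
    then show "f x \<le> (\<Sum>k<n. ?s k x)"
      using sum_slices[of "f x" n "real n"] f01 n by simp
  qed
  also have "\<Lambda> (\<lambda>x. \<Sum>k<m. ?s k x) = (\<Sum>k<m. \<Lambda> (?s k))" for m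
  proof (induction m)
    case (Suc m)
    have "continuous_map X euclideanreal (\<lambda>x. \<Sum>k<m. ?s k x)"
      using sc by (intro continuous_map_sum) auto
    from add[OF this sc] Suc show ?case by simp
  qed (simp add: zero)
  also have "(\<Sum>k<n. \<Lambda> (?s k)) \<le> (\<Sum>k<n. measure riesz (?U k) / n)"
  proof (rule sum_mono)
    fix k
    have "(\<lambda>x. real n * ?s k x) \<in> under (?U k)"
      unfolding under_def
    proof (intro CollectI conjI ballI)
      show "continuous_map X euclideanreal (\<lambda>x. real n * ?s k x)"
        by (intro continuous_intros sc)
      show "0 \<le> real n * ?s k x" for x
        using n by simp
      have "real n * ?s k x \<le> real n * (1 / real n)" for x
        by (rule mult_left_mono) auto
      then show "real n * ?s k x \<le> 1" for x
        using n by simp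
      show "real n * ?s k x = 0" if "x \<in> topspace X - ?U k" for x
        using that by (auto simp: min_def max_def)
    qed
    from inner_content_upper[OF this]
    have "real n * \<Lambda> (?s k) \<le> measure riesz (?U k)"
      by (simp add: scale[OF sc] measure_riesz_open openin_gt[OF fc])
    then show "\<Lambda> (?s k) \<le> measure riesz (?U k) / n"
      using n by (simp add: field_simps)
  qed
  also have "\<dots> = (\<Sum>k<n. \<integral>x. indicator (?U k) x / n \<partial>riesz)"
    using openin_sets_riesz[OF openin_gt[OF fc]]
    by (intro sum.cong) (auto intro!: arg_cong[where f = "measure riesz"])
  also have "\<dots> = (\<integral>x. (\<Sum>k<n. indicator (?U k) x / n) \<partial>riesz)"
    by (intro Bochner_Integration.integral_sum[symmetric] integrable_divide) (rule Ui)
  also have "\<dots> \<le> (\<integral>x. f x + 1 / n \<partial>riesz)"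
  proof (rule integral_mono)
    show "integrable riesz (\<lambda>x. \<Sum>k<n. indicator (?U k) x / real n)"
      by (intro Bochner_Integration.integrable_sum integrable_divide) (rule Ui)
    show "integrable riesz (\<lambda>x. f x + 1 / n)"
      using integrable_riesz[OF fc, of 1] f01 by auto
    fix x assume x: "x \<in> space riesz"
    have "(\<Sum>k<n. indicator (?U k) x / real n) = (\<Sum>k<n. if real k / real n < f x then 1 / real n else 0)"
      using x by (intro sum.cong) (auto simp: indicator_def)
    also have "\<dots> \<le> f x + 1 / n"
      using sum_indicator_le[of "f x" "real n" n] x f01 n by simp
    finally show "(\<Sum>k<n. indicator (?U k) x / real n) \<le> f x + 1 / n" .
  qed
  also have "\<dots> = integral\<^sup>L riesz f + 1 / n * \<Lambda> (\<lambda>x. 1)"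
    using integrable_riesz[OF fc, of 1] f01
    by (subst Bochner_Integration.integral_add) (auto simp: measure_riesz_open inner_content_topspace)
  also have "\<dots> \<le> integral\<^sup>L riesz f + e * \<Lambda> (\<lambda>x. 1)"
    using mult_right_mono[OF less_imp_le[OF n(2)] one_nonneg] by simp
  finally show "\<Lambda> f \<le> integral\<^sup>L riesz f + e * \<Lambda> (\<lambda>x. 1)" .
qed

text \<open>The missing inequality is the known one applied to 1 - f, because \<Lambda> and the
  integral give the constant 1 the same value.\<close>

lemma functional_eq_integral_unit:
  assumes fc: "continuous_map X euclideanreal f"
    and f01: "\<And>x. x \<in> topspace X \<Longrightarrow> 0 \<le> f x \<and> f x \<le> 1"
  shows "\<Lambda> f = integral\<^sup>L riesz f"
proof (rule antisym[OF functional_le_integral[OF assms]])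
  interpret finite_measure riesz by (rule finite_measure_riesz)
  have c: "continuous_map X euclideanreal (\<lambda>x. 1 + (-1) * f x)"
    and c1: "continuous_map X euclideanreal (\<lambda>x. (-1) * f x)"
    using fc by (auto intro!: continuous_intros)
  have i: "integrable riesz f" using integrable_riesz[OF fc, of 1] f01 by auto
  have "\<Lambda> (\<lambda>x. 1 + (-1) * f x) \<le> (\<integral>x. 1 + (-1) * f x \<partial>riesz)"
    by (rule functional_le_integral[OF c]) (use f01 in auto)
  also have "\<dots> = \<Lambda> (\<lambda>x. 1) - integral\<^sup>L riesz f"
    using i by (simp add: measure_riesz_open inner_content_topspace)
  finally show "integral\<^sup>L riesz f \<le> \<Lambda> f"
    using add[of "\<lambda>x. 1" "\<lambda>x. (-1) * f x"] c1 scale[OF fc, of "-1"] by simp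
qed

theorem Riesz_representation:
  assumes fc: "continuous_map X euclideanreal f"
  shows "has_bochner_integral riesz f (\<Lambda> f)"
proof -
  interpret finite_measure riesz by (rule finite_measure_riesz)
  have "compactin euclideanreal (f ` topspace X)"
    using compact fc unfolding compact_space_def by (rule image_compactin)
  then have "bounded (f ` topspace X)" by (simp add: compact_imp_bounded)
  then obtain c where c: "0 < c" "\<And>x. x \<in> topspace X \<Longrightarrow> \<bar>f x\<bar> \<le> c"
    by (auto simp: bounded_pos)
  have i: "integrable riesz f" by (rule integrable_riesz[OF fc c(2)])
  \<comment> \<open>The map \<open>t \<mapsto> 1/2 + t/(2c)\<close> carries [-c, c] onto [0, 1],
    where the identity is already known, and linearity undoes it.\<close>
  let ?h = "\<lambda>x. 1 / (2 * c) * f x"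
  have hc: "continuous_map X euclideanreal ?h" by (rule continuous_map_real_mult_left[OF fc])
  have "\<Lambda> (\<lambda>x. 1 / 2 + ?h x) = (\<integral>x. 1 / 2 + ?h x \<partial>riesz)"
  proof (rule functional_eq_integral_unit)
    show "continuous_map X euclideanreal (\<lambda>x. 1 / 2 + ?h x)" by (rule continuous_map_add[OF _ hc]) simp
    fix x assume "x \<in> topspace X"
    from c(2)[OF this] show "0 \<le> 1 / 2 + ?h x \<and> 1 / 2 + ?h x \<le> 1"
      using c(1) by (auto simp: field_simps abs_le_iff)
  qed
  moreover have "(\<integral>x. 1 / 2 + ?h x \<partial>riesz) = 1 / 2 * \<Lambda> (\<lambda>x. 1) + 1 / (2 * c) * integral\<^sup>L riesz f"
    using i by (subst Bochner_Integration.integral_add) (auto simp: measure_riesz_open inner_content_topspace)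
  moreover have "\<Lambda> (\<lambda>x. 1 / 2 + ?h x) = 1 / 2 * \<Lambda> (\<lambda>x. 1) + 1 / (2 * c) * \<Lambda> f"
    using add[OF _ hc, of "\<lambda>x. 1 / 2"] scale[of "\<lambda>x. 1" "1 / 2"] scale[OF fc, of "1 / (2 * c)"] by simp
  ultimately have "integral\<^sup>L riesz f = \<Lambda> f" using c(1) by simp
  with i show ?thesis by (simp add: has_bochner_integral_iff)
qed

end

section \<open>Positive functionals and extreme states\<close>

lemma open_coordinate_preimage:
  fixes W :: "'b::topological_space set"
  assumes "open W"
  shows "open {h :: 'a \<Rightarrow> 'b. h x \<in> W}"
  using open_vimage[OF assms continuous_on_product_coordinates[of x]] by (simp add: vimage_def)

text \<open>The three instances have to be declared in this order to supersede, class by class, the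
  ones derived from \<open>fun :: (countable, metric_space) metric_space\<close>.\<close>

instance "fun" :: (type, t0_space) t0_space
proof
  fix f g :: "'a \<Rightarrow> 'b"
  assume "f \<noteq> g"
  then obtain x where x: "f x \<noteq> g x" by auto
  obtain U where "open U" "\<not> (f x \<in> U \<longleftrightarrow> g x \<in> U)"
    using t0_space_class.t0_space[OF x] by blast
  then show "\<exists>U. open U \<and> \<not> (f \<in> U \<longleftrightarrow> g \<in> U)"
    by (intro exI[of _ "{h. h x \<in> U}"]) (auto intro: open_coordinate_preimage)
qed

instance "fun" :: (type, t1_space) t1_space
proof
  fix f g :: "'a \<Rightarrow> 'b"
  assume "f \<noteq> g"
  then obtain x where x: "f x \<noteq> g x" by auto
  obtain U where "open U" "f x \<in> U" "g x \<notin> U"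
    using t1_space_class.t1_space[OF x] by blast
  then show "\<exists>U. open U \<and> f \<in> U \<and> g \<notin> U"
    by (intro exI[of _ "{h. h x \<in> U}"]) (auto intro: open_coordinate_preimage)
qed

instance "fun" :: (type, t2_space) t2_space
proof
  fix f g :: "'a \<Rightarrow> 'b"
  assume "f \<noteq> g"
  then obtain x where x: "f x \<noteq> g x" by auto
  obtain U V where "open U" "open V" "f x \<in> U" "g x \<in> V" "U \<inter> V = {}"
    using hausdorff[OF x] by blast
  then show "\<exists>U V. open U \<and> open V \<and> f \<in> U \<and> g \<in> V \<and> U \<inter> V = {}"
    by (intro exI[of _ "{h. h x \<in> U}"] exI[of _ "{h. h x \<in> V}"])
      (auto intro: open_coordinate_preimage)
qed

section \<open>Cauchy-Schwarz and elements with bounded multiplication\<close>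

definition square_positive :: "('a::real_algebra_1 \<Rightarrow> real) \<Rightarrow> bool" where
  "square_positive L \<longleftrightarrow> linear L \<and> (\<forall>a. 0 \<le> L (a ^ 2))"

lemma square_positive_Cauchy_Schwarz:
  fixes L :: "'a::{real_algebra_1, comm_ring_1} \<Rightarrow> real"
  assumes "square_positive L"
  shows "(L (a * b))\<^sup>2 \<le> L (a ^ 2) * L (b ^ 2)"
proof -
  have lin: "linear L" and pos: "\<And>x. 0 \<le> L (x ^ 2)"
    using assms by (auto simp: square_positive_def)
  have q: "0 \<le> L (a ^ 2) + 2 * t * L (a * b) + t\<^sup>2 * L (b ^ 2)" for t
  proof -
    have "(a + t *\<^sub>R b) ^ 2 = a ^ 2 + (2 * t) *\<^sub>R (a * b) + t\<^sup>2 *\<^sub>R (b ^ 2)"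
      by (simp only: mult_2 scaleR_left_distrib scaleR_add_right power2_eq_square distrib_left distrib_right
          mult_scaleR_left mult_scaleR_right scaleR_scaleR mult.commute[of b a] add.assoc)
    then show ?thesis
      using pos[of "a + t *\<^sub>R b"] by (simp add: linear_add[OF lin] linear_scale[OF lin])
  qed
  show ?thesis
  proof (cases "L (b ^ 2) = 0")
    case True
    have "L (a * b) = 0"
    proof (rule ccontr)
      assume "L (a * b) \<noteq> 0"
      \<comment> \<open>When L(b^2) = 0 the quadratic is affine in t; this t makes it equal to
        -1.\<close>
      then show False
        using q[of "- (L (a ^ 2) + 1) / (2 * L (a * b))"] True by (simp add: field_simps)
    qed
    then show ?thesis using True by simp
  next
    case False
    then have C: "0 < L (b ^ 2)" using pos[of b] by simp
    have "0 \<le> L (a ^ 2) - (L (a * b))\<^sup>2 / L (b ^ 2)"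
      using q[of "- L (a * b) / L (b ^ 2)"] C by (simp add: power2_eq_square field_simps)
    then show ?thesis using C by (simp add: field_simps)
  qed
qed

text \<open>With u k = L(a^(2 2^k) c^2) and N = L(c^2), Cauchy-Schwarz gives (u k)^2 <= u (k+1) N,
  so x = u 0 / N satisfies x^(2^k) <= u k / N <= (D/N) K^(2^k). Letting k grow removes the factor
  D/N and leaves x <= K.\<close>

lemma square_positive_power_bound:
  fixes L :: "'a::{real_algebra_1, comm_ring_1} \<Rightarrow> real"
  assumes L: "square_positive L" and K: "0 \<le> K"
    and growth: "\<And>k. L (a ^ (2 * 2 ^ k) * c ^ 2) \<le> D * K ^ (2 ^ k)"
  shows "L (a ^ 2 * c ^ 2) \<le> K * L (c ^ 2)"
proof -
  define N where "N = L (c ^ 2)"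
  define u where "u k = L (a ^ (2 * 2 ^ k) * c ^ 2)" for k :: nat
  have pos: "\<And>x. 0 \<le> L (x ^ 2)" using L by (auto simp: square_positive_def)
  have N: "0 \<le> N" by (simp add: N_def pos)
  have u_nonneg: "0 \<le> u k" for k
    using pos[of "a ^ (2 ^ k) * c"] by (simp add: u_def power_mult_distrib mult.commute flip: power_mult)
  have step: "(u k)\<^sup>2 \<le> u (Suc k) * N" for k
  proof -
    have "a ^ (2 * 2 ^ Suc k) = (a ^ (2 * 2 ^ k)) ^ 2" by (simp flip: power_mult add: mult.commute)
    then show ?thesis
      using square_positive_Cauchy_Schwarz[OF L, of "a ^ (2 * 2 ^ k) * c" c]
      by (simp add: u_def N_def power_mult_distrib mult.assoc power2_eq_square[of c])
  qed
  show ?thesis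
  proof (cases "N = 0")
    case True
    then show ?thesis using step[of 0] by (simp add: u_def flip: N_def)
  next
    case False
    with N have N0: "0 < N" by simp
    define x where "x = u 0 / N"
    have x0: "0 \<le> x" using N0 u_nonneg by (simp add: x_def)
    have iter: "x ^ (2 ^ k) \<le> u k / N" for k
    proof (induction k)
      case 0
      then show ?case by (simp add: x_def)
    next
      case (Suc k)
      have "x ^ (2 ^ Suc k) = (x ^ (2 ^ k))\<^sup>2" by (simp only: power_Suc2 power_mult)
      also have "\<dots> \<le> (u k / N)\<^sup>2" using Suc x0 by (intro power_mono) auto
      also have "\<dots> \<le> u (Suc k) / N"
        using step[of k] N0 by (simp add: power2_eq_square field_simps)
      finally show ?case .
    qed
    have bound: "x ^ (2 ^ k) \<le> D / N * K ^ (2 ^ k)" for k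
      using iter[of k] growth[of k] N0 by (simp add: u_def divide_right_mono order_trans)
    have "x \<le> K"
    proof (rule ccontr)
      assume "\<not> x \<le> K"
      then have xK: "K < x" by simp
      show False
      proof (cases "K = 0")
        case True
        then show ?thesis using bound[of 0] xK by simp
      next
        case False
        with K have K0: "0 < K" by simp
        then have gt: "1 < x / K" using xK by simp
        then obtain n where n: "D / N < (x / K) ^ n" using real_arch_pow by blast
        have "(x / K) ^ n \<le> (x / K) ^ (2 ^ n)"
          using gt by (intro power_increasing) (auto simp: less_imp_le)
        also have "\<dots> \<le> D / N"
          using bound[of n] K0 by (simp add: power_divide field_simps)
        finally show False using n by simp
      qed
    qed
    then have "u 0 \<le> K * N" using N0 by (simp only: x_def pos_divide_le_eq)
    then show ?thesis by (simp add: u_def N_def)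
  qed
qed

text \<open>Since a^2 c^2 = (a c)^2, these are the elements that act by multiplication as bounded
  operators for the semi-inner product L(xy); K bounds the squared operator norm.\<close>

definition bounded_elements :: "('a::real_algebra_1 \<Rightarrow> real) \<Rightarrow> 'a set" where
  "bounded_elements L = {a. \<exists>K\<ge>0. \<forall>c. L (a ^ 2 * c ^ 2) \<le> K * L (c ^ 2)}"

lemma bounded_elements_subalgebra:
  fixes L :: "'a::{real_algebra_1, comm_ring_1} \<Rightarrow> real"
  assumes "square_positive L"
  shows "unital_subalgebra (bounded_elements L)"
proof -
  have lin: "linear L" and pos: "\<And>x. 0 \<le> L (x ^ 2)"
    using assms by (auto simp: square_positive_def)
  have one: "1 \<in> bounded_elements L"
    by (auto simp: bounded_elements_def intro!: exI[of _ 1])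
  have scale: "r *\<^sub>R a \<in> bounded_elements L" if a: "a \<in> bounded_elements L" for r a
  proof -
    obtain K where K: "0 \<le> K" "\<And>c. L (a ^ 2 * c ^ 2) \<le> K * L (c ^ 2)"
      using a by (auto simp: bounded_elements_def)
    have "L ((r *\<^sub>R a) ^ 2 * c ^ 2) \<le> (r\<^sup>2 * K) * L (c ^ 2)" for c
    proof -
      have "L ((r *\<^sub>R a) ^ 2 * c ^ 2) = r\<^sup>2 * L (a ^ 2 * c ^ 2)"
        by (simp add: power2_eq_square linear_scale[OF lin])
      then show ?thesis
        using K(2)[of c] by (simp add: mult.assoc mult_left_mono)
    qed
    then show ?thesis using K(1) by (auto simp: bounded_elements_def intro!: exI[of _ "r\<^sup>2 * K"])
  qed
  have add: "a + b \<in> bounded_elements L"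
    if a: "a \<in> bounded_elements L" and b: "b \<in> bounded_elements L" for a b
  proof -
    obtain K where K: "0 \<le> K" "\<And>c. L (a ^ 2 * c ^ 2) \<le> K * L (c ^ 2)"
      using a by (auto simp: bounded_elements_def)
    obtain M where M: "0 \<le> M" "\<And>c. L (b ^ 2 * c ^ 2) \<le> M * L (c ^ 2)"
      using b by (auto simp: bounded_elements_def)
    have "L ((a + b) ^ 2 * c ^ 2) \<le> (2 * K + 2 * M) * L (c ^ 2)" for c
    proof -
      \<comment> \<open>The parallelogram identity replaces the triangle inequality; dropping the
        nonnegative term with a - b leaves the constant 2K + 2M.\<close>
      have "((a + b) * c) ^ 2 + ((a - b) * c) ^ 2
          = (a ^ 2 * c ^ 2 + a ^ 2 * c ^ 2) + (b ^ 2 * c ^ 2 + b ^ 2 * c ^ 2)"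
        by (simp add: power2_eq_square algebra_simps)
      from arg_cong[OF this, of L]
      have "L (((a + b) * c) ^ 2) + L (((a - b) * c) ^ 2)
          = 2 * L (a ^ 2 * c ^ 2) + 2 * L (b ^ 2 * c ^ 2)"
        by (simp only: linear_add[OF lin] mult_2)
      then have "L ((a + b) ^ 2 * c ^ 2) \<le> 2 * L (a ^ 2 * c ^ 2) + 2 * L (b ^ 2 * c ^ 2)"
        using pos[of "(a - b) * c"] by (simp add: power_mult_distrib)
      also have "\<dots> \<le> (2 * K + 2 * M) * L (c ^ 2)"
        using K(2)[of c] M(2)[of c] by (simp add: algebra_simps)
      finally show ?thesis .
    qed
    then show ?thesis
      using K(1) M(1) by (auto simp: bounded_elements_def intro!: exI[of _ "2 * K + 2 * M"])
  qed
  have mult: "a * b \<in> bounded_elements L"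
    if a: "a \<in> bounded_elements L" and b: "b \<in> bounded_elements L" for a b
  proof -
    obtain K where K: "0 \<le> K" "\<And>c. L (a ^ 2 * c ^ 2) \<le> K * L (c ^ 2)"
      using a by (auto simp: bounded_elements_def)
    obtain M where M: "0 \<le> M" "\<And>c. L (b ^ 2 * c ^ 2) \<le> M * L (c ^ 2)"
      using b by (auto simp: bounded_elements_def)
    have "L ((a * b) ^ 2 * c ^ 2) \<le> (K * M) * L (c ^ 2)" for c
    proof -
      have "L ((a * b) ^ 2 * c ^ 2) = L (a ^ 2 * (b * c) ^ 2)"
        by (simp add: power_mult_distrib mult.assoc)
      also have "\<dots> \<le> K * L ((b * c) ^ 2)" by (rule K)
      also have "\<dots> \<le> K * (M * L (c ^ 2))"
        using M(2)[of c] K(1) by (intro mult_left_mono) (auto simp: power_mult_distrib)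
      finally show ?thesis by (simp add: mult.assoc)
    qed
    then show ?thesis
      using K(1) M(1) by (auto simp: bounded_elements_def intro!: exI[of _ "K * M"])
  qed
  show ?thesis
    unfolding unital_subalgebra_def subspace_def
    using one add mult scale scale[OF one, of 0] by auto
qed

section \<open>Normalised positive functionals with prescribed bounds\<close>

definition states :: "('a::real_algebra_1 \<Rightarrow> real) \<Rightarrow> ('a \<Rightarrow> real) set" where
  "states K = {\<phi>. linear \<phi> \<and> \<phi> 1 = 1 \<and> (\<forall>a. 0 \<le> \<phi> (a ^ 2)) \<and>
                  (\<forall>a c. \<phi> (a ^ 2 * c ^ 2) \<le> K a * \<phi> (c ^ 2))}"

lemma states_square_positive: "\<phi> \<in> states K \<Longrightarrow> square_positive \<phi>"
  by (simp add: states_def square_positive_def)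

lemma continuous_on_eval: "continuous_on S (\<lambda>\<phi> :: 'a \<Rightarrow> real. \<phi> a)" for S :: "('a \<Rightarrow> real) set"
  by (rule continuous_on_subset[OF continuous_on_product_coordinates]) simp

lemma closed_states: "closed (states K)"
  unfolding states_def linear_iff
  by (intro closed_Collect_conj closed_Collect_all closed_Collect_eq closed_Collect_le
        continuous_intros continuous_on_eval)

lemma closed_characters: "closed (characters :: ('a::real_algebra_1 \<Rightarrow> real) set)"
  unfolding characters_def linear_iff
  by (intro closed_Collect_conj closed_Collect_all closed_Collect_eq
        continuous_intros continuous_on_eval)

text \<open>Taking c = 1 in the defining bound gives (\<phi> a)^2 <= \<phi>(a^2) <= K a. The states
  therefore form a closed subset of a product of intervals, compact by Tychonoff; the radius
  \<open>K a + 1\<close> avoids square roots.\<close>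

lemma compact_states:
  fixes K :: "'a::{real_algebra_1, comm_ring_1} \<Rightarrow> real"
  shows "compact (states K)"
proof -
  let ?B = "PiE UNIV (\<lambda>a. {- (K a + 1)..K a + 1})"
  have "compactin (product_topology (\<lambda>_. euclideanreal) UNIV) ?B"
    unfolding compactin_PiE by simp
  then have "compact ?B" by (simp only: euclidean_product_topology compactin_euclidean_iff)
  moreover have "states K \<subseteq> ?B"
  proof
    fix \<phi> assume \<phi>: "\<phi> \<in> states K"
    have "\<bar>\<phi> a\<bar> \<le> K a + 1" for a
    proof -
      have one: "\<phi> 1 = 1" and le: "\<phi> (a ^ 2 * 1 ^ 2) \<le> K a * \<phi> (1 ^ 2)"
        using \<phi> unfolding states_def by blast+
      have "(\<phi> a)\<^sup>2 \<le> K a"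
        using square_positive_Cauchy_Schwarz[OF states_square_positive[OF \<phi>], of a 1] one le by simp
      moreover have "\<bar>\<phi> a\<bar> \<le> (\<phi> a)\<^sup>2 + 1"
        using sum_squares_bound[of 1 "\<bar>\<phi> a\<bar>"] by simp
      ultimately show ?thesis by linarith
    qed
    then show "\<phi> \<in> ?B" by (force simp: PiE_UNIV_domain abs_le_iff)
  qed
  ultimately show ?thesis
    using closed_states by (metis Int_absorb1 compact_Int_closed)
qed

section \<open>Closed faces and extreme points\<close>

definition face :: "('a \<Rightarrow> real) set \<Rightarrow> ('a \<Rightarrow> real) set \<Rightarrow> bool" where
  "face S F \<longleftrightarrow> F \<noteq> {} \<and> closed F \<and> F \<subseteq> S \<and>
     (\<forall>\<phi>\<in>S. \<forall>\<psi>\<in>S. \<forall>t. 0 < t \<and> t < 1 \<and> (\<lambda>x. t * \<phi> x + (1 - t) * \<psi> x) \<in> F \<longrightarrow> \<phi> \<in> F \<and> \<psi> \<in> F)"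

lemma face_minimizers:
  assumes S: "compact S" and F: "face S F"
  shows "face S {\<phi> \<in> F. \<forall>\<psi>\<in>F. \<phi> a \<le> \<psi> a}"
proof -
  have Fc: "compact F"
    using F S compact_Int_closed[of S F] by (auto simp: face_def Int_absorb1)
  have ne: "{\<phi> \<in> F. \<forall>\<psi>\<in>F. \<phi> a \<le> \<psi> a} \<noteq> {}"
    using continuous_attains_inf[OF Fc _ continuous_on_eval[of _ a]] F by (auto simp: face_def)
  have "closed (F \<inter> (\<Inter>\<psi>\<in>F. {\<phi>. \<phi> a \<le> \<psi> a}))"
    using F by (intro closed_Int closed_INT ballI closed_Collect_le continuous_on_eval continuous_on_const)
      (auto simp: face_def)
  moreover have "F \<inter> (\<Inter>\<psi>\<in>F. {\<phi>. \<phi> a \<le> \<psi> a}) = {\<phi> \<in> F. \<forall>\<psi>\<in>F. \<phi> a \<le> \<psi> a}" by auto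
  ultimately have cl: "closed {\<phi> \<in> F. \<forall>\<psi>\<in>F. \<phi> a \<le> \<psi> a}" by simp
  show ?thesis
    unfolding face_def
  proof (intro conjI ne cl ballI allI impI; (elim conjE)?)
    show "{\<phi> \<in> F. \<forall>\<psi>\<in>F. \<phi> a \<le> \<psi> a} \<subseteq> S" using F by (auto simp: face_def)
    fix \<phi> \<psi> and t :: real
    assume S: "\<phi> \<in> S" "\<psi> \<in> S" and t: "0 < t" "t < 1"
      and mem: "(\<lambda>x. t * \<phi> x + (1 - t) * \<psi> x) \<in> {\<phi> \<in> F. \<forall>\<psi>\<in>F. \<phi> a \<le> \<psi> a}"
    have inF: "\<phi> \<in> F" "\<psi> \<in> F" using F S t mem unfolding face_def by blast+
    have min: "\<And>\<eta>. \<eta> \<in> F \<Longrightarrow> t * \<phi> a + (1 - t) * \<psi> a \<le> \<eta> a" using mem by blast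
    \<comment> \<open>A convex combination with positive weights that is at most both endpoint
      values forces these values to coincide.\<close>
    have "(1 - t) * \<psi> a \<le> (1 - t) * \<phi> a" using min[OF inF(1)] by (simp add: algebra_simps)
    then have 1: "\<psi> a \<le> \<phi> a" using t by simp
    have "t * \<phi> a \<le> t * \<psi> a" using min[OF inF(2)] by (simp add: algebra_simps)
    then have "\<phi> a \<le> \<psi> a" using t by simp
    with 1 have eq: "\<phi> a = \<psi> a" by simp
    have "t * \<phi> a + (1 - t) * \<psi> a = \<phi> a" by (simp add: eq algebra_simps)
    then show "\<phi> \<in> {\<phi> \<in> F. \<forall>\<psi>\<in>F. \<phi> a \<le> \<psi> a}" "\<psi> \<in> {\<phi> \<in> F. \<forall>\<psi>\<in>F. \<phi> a \<le> \<psi> a}"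
      using inF min eq by auto
  qed
qed

lemma minimal_face:
  assumes S: "compact S" and F0: "face S F0"
  obtains F where "face S F" "F \<subseteq> F0" "\<And>G. face S G \<Longrightarrow> G \<subseteq> F \<Longrightarrow> G = F"
proof -
  \<comment> \<open>Zorn's lemma provides maximal elements for inclusion; complements turn them into
    minimal faces.\<close>
  let ?A = "uminus ` {F. face S F \<and> F \<subseteq> F0}"
  have "\<exists>M\<in>?A. \<forall>X\<in>?A. M \<subseteq> X \<longrightarrow> X = M"
  proof (rule subset_Zorn_nonempty)
    show "?A \<noteq> {}" using F0 by blast
    fix \<C> assume ne: "\<C> \<noteq> {}" and ch: "subset.chain ?A \<C>"
    define \<D> where "\<D> = uminus ` \<C>"
    have D: "\<And>F. F \<in> \<D> \<Longrightarrow> face S F \<and> F \<subseteq> F0"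
      using ch by (auto simp: \<D>_def subset.chain_def subset_iff)
    have cmp: "F \<subseteq> G \<or> G \<subseteq> F" if "F \<in> \<D>" "G \<in> \<D>" for F G
    proof -
      have "- F \<in> \<C>" "- G \<in> \<C>" using that by (auto simp: \<D>_def)
      then have "- F \<subseteq> - G \<or> - G \<subseteq> - F" using ch unfolding subset_chain_def by blast
      then show ?thesis by auto
    qed
    obtain F1 where F1: "F1 \<in> \<D>" using ne by (auto simp: \<D>_def)
    have dir: "\<exists>G\<in>\<D>. G \<subseteq> \<Inter>\<F>" if "finite \<F>" "\<F> \<subseteq> \<D>" for \<F>
      using that
    proof (induction \<F> rule: finite_induct)
      case empty
      then show ?case using F1 by auto
    next
      case (insert F \<F>)
      then obtain G where "G \<in> \<D>" "G \<subseteq> \<Inter>\<F>" by auto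
      moreover have "F \<in> \<D>" using insert by simp
      ultimately show ?case using cmp[of F G] by (auto intro: bexI[of _ F] bexI[of _ G])
    qed
    \<comment> \<open>Compactness enters here: finitely many members of the chain contain a common
      member, which is nonempty, so the whole intersection is nonempty.\<close>
    have "S \<inter> \<Inter>\<D> \<noteq> {}"
    proof (rule compact_imp_fip[OF S])
      show "closed T" if "T \<in> \<D>" for T using D[OF that] by (simp add: face_def)
      fix \<F> assume "finite \<F>" "\<F> \<subseteq> \<D>"
      then obtain G where "G \<in> \<D>" "G \<subseteq> \<Inter>\<F>" using dir by blast
      then show "S \<inter> \<Inter>\<F> \<noteq> {}" using D[of G] unfolding face_def by blast
    qed
    then have ne: "\<Inter>\<D> \<noteq> {}" by blast
    have cl: "closed (\<Inter>\<D>)" using D by (auto simp: face_def)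
    have sub: "\<Inter>\<D> \<subseteq> F0" "\<Inter>\<D> \<subseteq> S" using D[OF F1] F1 by (auto simp: face_def)
    have ext: "\<phi> \<in> \<Inter>\<D> \<and> \<psi> \<in> \<Inter>\<D>"
      if "\<phi> \<in> S" "\<psi> \<in> S" "0 < t" "t < 1" "(\<lambda>x. t * \<phi> x + (1 - t) * \<psi> x) \<in> \<Inter>\<D>" for \<phi> \<psi> t
    proof -
      have "\<phi> \<in> F \<and> \<psi> \<in> F" if "F \<in> \<D>" for F
      proof -
        have "(\<lambda>x. t * \<phi> x + (1 - t) * \<psi> x) \<in> F"
          using \<open>(\<lambda>x. t * \<phi> x + (1 - t) * \<psi> x) \<in> \<Inter>\<D>\<close> that by (rule InterD)
        then show ?thesis
          using D[OF that] \<open>\<phi> \<in> S\<close> \<open>\<psi> \<in> S\<close> \<open>0 < t\<close> \<open>t < 1\<close> unfolding face_def by blast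
      qed
      then show ?thesis by blast
    qed
    have "face S (\<Inter>\<D>)"
      unfolding face_def
    proof (intro conjI ne cl sub ballI allI impI; (elim conjE)?)
      fix \<phi> \<psi> and t :: real
      assume "\<phi> \<in> S" "\<psi> \<in> S" "0 < t" "t < 1" "(\<lambda>x. t * \<phi> x + (1 - t) * \<psi> x) \<in> \<Inter>\<D>"
      from ext[OF this] show "\<phi> \<in> \<Inter>\<D>" "\<psi> \<in> \<Inter>\<D>" by blast+
    qed
    moreover have "\<Union>\<C> = - \<Inter>\<D>" by (auto simp: \<D>_def)
    ultimately show "\<Union>\<C> \<in> ?A" using \<open>\<Inter>\<D> \<subseteq> F0\<close> by blast
  qed
  then obtain F where F: "face S F" "F \<subseteq> F0"
    "\<And>G. face S G \<Longrightarrow> G \<subseteq> F0 \<Longrightarrow> - F \<subseteq> - G \<Longrightarrow> - G = - F"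
    by auto
  show thesis
    by (rule that[OF F(1,2)]) (use F in blast)
qed

text \<open>A weak form of the Krein--Milman theorem; a minimal closed face is a singleton because
  each evaluation is constant on it.\<close>
lemma extreme_minimizer:
  fixes S :: "('a \<Rightarrow> real) set"
  assumes S: "compact S" "S \<noteq> {}"
  obtains e where "e \<in> S" "\<And>\<phi>. \<phi> \<in> S \<Longrightarrow> e a \<le> \<phi> a"
    "\<And>\<phi> \<psi> t. \<phi> \<in> S \<Longrightarrow> \<psi> \<in> S \<Longrightarrow> 0 < t \<Longrightarrow> t < 1 \<Longrightarrow>
       e = (\<lambda>x. t * \<phi> x + (1 - t) * \<psi> x) \<Longrightarrow> \<phi> = e"
proof -
  have "face S S" using S by (simp add: face_def compact_imp_closed)
  \<comment> \<open>The minimal face is taken inside the face of minimisers of evaluation at a, so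
    that its single point is extreme and minimising at once.\<close>
  then obtain F where F: "face S F" "F \<subseteq> {\<phi> \<in> S. \<forall>\<psi>\<in>S. \<phi> a \<le> \<psi> a}"
    "\<And>G. face S G \<Longrightarrow> G \<subseteq> F \<Longrightarrow> G = F"
    by (rule minimal_face[OF S(1) face_minimizers[OF S(1), of S a]]) blast+
  obtain e where e: "e \<in> F" using F(1) by (auto simp: face_def)
  have single: "\<phi> = e" if "\<phi> \<in> F" for \<phi>
  proof
    fix x
    have "{\<phi> \<in> F. \<forall>\<psi>\<in>F. \<phi> x \<le> \<psi> x} = F"
      using F(3)[OF face_minimizers[OF S(1) F(1)]] by blast
    then show "\<phi> x = e x" using that e by (blast intro: antisym)
  qed
  show thesis
  proof (rule that[of e])
    show "e \<in> S" "\<And>\<phi>. \<phi> \<in> S \<Longrightarrow> e a \<le> \<phi> a" using e F(2) by auto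
    fix \<phi> \<psi> and t :: real
    assume S: "\<phi> \<in> S" "\<psi> \<in> S" "0 < t" "t < 1" and eq: "e = (\<lambda>x. t * \<phi> x + (1 - t) * \<psi> x)"
    have "(\<lambda>x. t * \<phi> x + (1 - t) * \<psi> x) \<in> F" using eq e by (rule subst[where P = "\<lambda>f. f \<in> F"])
    then have "\<phi> \<in> F" using F(1) S unfolding face_def by blast
    then show "\<phi> = e" by (rule single)
  qed
qed

text \<open>Iterating the bound controls all even powers at once; this feeds the growth condition of
  \<open>square_positive_power_bound\<close>.\<close>

lemma states_power_bound:
  fixes K :: "'a::{real_algebra_1, comm_ring_1} \<Rightarrow> real"
  assumes e: "e \<in> states K" and K: "\<And>a. 0 \<le> K a"
  shows "e (a ^ (2 * m) * d ^ 2) \<le> K a ^ m * e (d ^ 2)"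
proof (induction m)
  case (Suc m)
  have "e (a ^ (2 * Suc m) * d ^ 2) = e (a ^ 2 * (a ^ m * d) ^ 2)"
  proof -
    have "a ^ (2 * Suc m) = a ^ 2 * (a ^ m) ^ 2"
      by (simp only: power_mult[symmetric] power_add[symmetric] mult_Suc_right mult.commute[of m])
    then show ?thesis by (simp add: power_mult_distrib mult.assoc)
  qed
  also have "\<dots> \<le> K a * e ((a ^ m * d) ^ 2)" using e by (simp add: states_def)
  also have "(a ^ m * d) ^ 2 = a ^ (2 * m) * d ^ 2"
    by (simp add: power_mult_distrib mult.commute flip: power_mult)
  also have "K a * e (a ^ (2 * m) * d ^ 2) \<le> K a * (K a ^ m * e (d ^ 2))"
    using Suc K by (intro mult_left_mono) auto
  finally show ?case by (simp add: mult.assoc)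
qed simp

text \<open>A state \<open>e\<close> is a convex combination of the normalisations of \<open>x \<mapsto> e (c\<^sup>2 x)\<close> and
  \<open>x \<mapsto> e ((N - c\<^sup>2) x)\<close> for every large \<open>N\<close>.\<close>
lemma extreme_state_multiplicative:
  fixes K :: "'a::{real_algebra_1, comm_ring_1} \<Rightarrow> real"
  assumes e: "e \<in> states K" and K: "\<And>a. 0 \<le> K a"
    and ext: "\<And>\<phi> \<psi> t. \<phi> \<in> states K \<Longrightarrow> \<psi> \<in> states K \<Longrightarrow> 0 < t \<Longrightarrow> t < 1 \<Longrightarrow>
       e = (\<lambda>x. t * \<phi> x + (1 - t) * \<psi> x) \<Longrightarrow> \<phi> = e"
  shows "e (c ^ 2 * x) = e (c ^ 2) * e x"
proof (cases "e (c ^ 2) = 0")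
  case True
  \<comment> \<open>The degenerate case admits no normalisation by e(c^2); Cauchy-Schwarz for the
    factors c and c x shows that both sides vanish.\<close>
  have "(e (c * (c * x)))\<^sup>2 \<le> 0"
    using square_positive_Cauchy_Schwarz[OF states_square_positive[OF e], of c "c * x"] True by simp
  then have "e (c * (c * x)) = 0" by simp
  then show ?thesis using True by (simp add: power2_eq_square mult.assoc)
next
  case False
  have lin: "linear e" and one: "e 1 = 1" and pos: "\<And>a. 0 \<le> e (a ^ 2)"
    and bd: "\<And>a c. e (a ^ 2 * c ^ 2) \<le> K a * e (c ^ 2)"
    using e by (auto simp: states_def)
  define s where "s = e (c ^ 2)"
  \<comment> \<open>N >= K c makes \<open>\<psi>'\<close> nonnegative on squares, and the extra 1
    makes N - e(c^2) strictly positive, so that \<psi> can be normalised.\<close>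
  define N where "N = K c + 1"
  have s0: "0 < s" using False pos[of c] by (simp add: s_def)
  have sN: "s < N" using bd[of c 1] one by (simp add: s_def N_def)
  have N0: "0 < N" using s0 sN by simp
  define \<phi> where "\<phi> x = e (c ^ 2 * x) / s" for x
  define \<psi>' where "\<psi>' x = N * e x - e (c ^ 2 * x)" for x
  define \<psi> where "\<psi> x = \<psi>' x / (N - s)" for x
  have \<phi>: "\<phi> \<in> states K"
    unfolding states_def
  proof (intro CollectI conjI allI)
    show "linear \<phi>"
      by (auto simp: linear_iff \<phi>_def linear_add[OF lin] linear_scale[OF lin] distrib_left add_divide_distrib)
    show "\<phi> 1 = 1" using s0 by (simp add: \<phi>_def s_def)
    show "0 \<le> \<phi> (a ^ 2)" for a
      using pos[of "c * a"] s0 by (simp add: \<phi>_def power_mult_distrib)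
    show "\<phi> (a ^ 2 * d ^ 2) \<le> K a * \<phi> (d ^ 2)" for a d
      using bd[of a "c * d"] s0
      by (simp add: \<phi>_def power_mult_distrib divide_right_mono ac_simps)
  qed
  have lin': "linear \<psi>'"
    by (auto simp: linear_iff \<psi>'_def linear_add[OF lin] linear_scale[OF lin] algebra_simps)
  have pos': "0 \<le> \<psi>' (a ^ 2)" for a
  proof -
    have "e (c ^ 2 * a ^ 2) \<le> K c * e (a ^ 2)" by (rule bd)
    also have "\<dots> \<le> N * e (a ^ 2)" using pos[of a] by (simp add: N_def algebra_simps)
    finally show ?thesis by (simp add: \<psi>'_def)
  qed
  have sp: "square_positive \<psi>'" using lin' pos' by (simp add: square_positive_def)
  \<comment> \<open>Subtracting the bounds for the two parts of \<open>\<psi>'\<close> would go in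
    the wrong direction. On squares \<open>\<psi>'\<close> is at most N e, which gives the growth
    rate K a with the crude constant N e(d^2); the power bound then restores the exact constant K
    a.\<close>
  have bd': "\<psi>' (a ^ 2 * d ^ 2) \<le> K a * \<psi>' (d ^ 2)" for a d
  proof (rule square_positive_power_bound[OF sp K, where D = "N * e (d ^ 2)"])
    fix k
    have "0 \<le> e (c ^ 2 * (a ^ (2 * 2 ^ k) * d ^ 2))"
      using pos[of "c * (a ^ (2 ^ k) * d)"] by (simp add: power_mult_distrib mult.commute flip: power_mult)
    then have "\<psi>' (a ^ (2 * 2 ^ k) * d ^ 2) \<le> N * e (a ^ (2 * 2 ^ k) * d ^ 2)"
      by (simp add: \<psi>'_def)
    also have "\<dots> \<le> N * (K a ^ (2 ^ k) * e (d ^ 2))"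
      using N0 states_power_bound[OF e K] by (intro mult_left_mono) auto
    finally show "\<psi>' (a ^ (2 * 2 ^ k) * d ^ 2) \<le> N * e (d ^ 2) * K a ^ (2 ^ k)"
      by (simp add: ac_simps)
  qed
  have \<psi>: "\<psi> \<in> states K"
    unfolding states_def
  proof (intro CollectI conjI allI)
    show "linear \<psi>"
      by (auto simp: linear_iff \<psi>_def linear_add[OF lin'] linear_scale[OF lin'] add_divide_distrib)
    show "\<psi> 1 = 1" using sN by (simp add: \<psi>_def \<psi>'_def one s_def)
    show "0 \<le> \<psi> (a ^ 2)" for a using pos'[of a] sN by (simp add: \<psi>_def)
    show "\<psi> (a ^ 2 * d ^ 2) \<le> K a * \<psi> (d ^ 2)" for a d
      using bd'[of a d] sN by (simp add: \<psi>_def divide_right_mono)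
  qed
  have "\<phi> = e"
  proof (rule ext[OF \<phi> \<psi>, of "s / N"])
    show "0 < s / N" "s / N < 1" using s0 sN N0 by auto
    have "s / N * \<phi> x = e (c ^ 2 * x) / N" for x using s0 N0 by (simp add: \<phi>_def)
    moreover have "(1 - s / N) * \<psi> x = \<psi>' x / N" for x
    proof -
      have "1 - s / N = (N - s) / N" using N0 by (simp add: diff_divide_distrib)
      then show ?thesis using sN by (simp add: \<psi>_def)
    qed
    ultimately show "e = (\<lambda>x. s / N * \<phi> x + (1 - s / N) * \<psi> x)"
      using N0 by (auto simp: \<psi>'_def diff_divide_distrib)
  qed
  then have "e x = e (c ^ 2 * x) / s" by (metis \<phi>_def)
  then show ?thesis using s0 by (simp add: s_def)
qed

text \<open>Polarisation: 4 c y = (c + 1)^2 y - (c - 1)^2 y. Taking y = 1 identifies the factor in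
  front of e y as 4 e c.\<close>

lemma multiplicative_on_squares_character:
  fixes e :: "'a::{real_algebra_1, comm_ring_1} \<Rightarrow> real"
  assumes lin: "linear e" and one: "e 1 = 1"
    and sq: "\<And>c x. e (c ^ 2 * x) = e (c ^ 2) * e x"
  shows "e \<in> characters"
proof -
  have "e (c * x) = e c * e x" for c x
  proof -
    have 1: "4 *\<^sub>R (c * y) = (c + 1) ^ 2 * y + (- 1) *\<^sub>R ((c - 1) ^ 2 * y)" for y
    proof -
      have "4 *\<^sub>R (c * y) = (2 *\<^sub>R (2 *\<^sub>R (c * y)))" by simp
      also have "\<dots> = (c + 1) ^ 2 * y + (- 1) *\<^sub>R ((c - 1) ^ 2 * y)"
        unfolding scaleR_2 by (simp add: power2_eq_square algebra_simps)
      finally show ?thesis .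
    qed
    have 2: "4 * e (c * y) = (e ((c + 1) ^ 2) - e ((c - 1) ^ 2)) * e y" for y
      using arg_cong[OF 1[of y], of e]
      by (simp only: linear_add[OF lin] linear_scale[OF lin] sq) (simp add: algebra_simps)
    have "e ((c + 1) ^ 2) - e ((c - 1) ^ 2) = 4 * e c" using 2[of 1] by (simp add: one)
    then show ?thesis using 2[of x] by simp
  qed
  then show ?thesis using lin one by (simp add: characters_def)
qed

lemma state_le_characters:
  fixes K :: "'a::{real_algebra_1, comm_ring_1} \<Rightarrow> real"
  assumes L: "L \<in> states K" and K: "\<And>a. 0 \<le> K a"
  obtains \<alpha> where "\<alpha> \<in> characters \<inter> states K" "\<alpha> a \<le> L a"
proof -
  obtain e where e: "e \<in> states K" "\<And>\<phi>. \<phi> \<in> states K \<Longrightarrow> e a \<le> \<phi> a"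
    "\<And>\<phi> \<psi> t. \<phi> \<in> states K \<Longrightarrow> \<psi> \<in> states K \<Longrightarrow> 0 < t \<Longrightarrow> t < 1 \<Longrightarrow>
       e = (\<lambda>x. t * \<phi> x + (1 - t) * \<psi> x) \<Longrightarrow> \<phi> = e"
    using extreme_minimizer[OF compact_states[of K], of a] L by blast
  have "e \<in> characters"
    using extreme_state_multiplicative[OF e(1) K e(3)] e(1)
    by (intro multiplicative_on_squares_character) (auto simp: states_def)
  with e(1) e(2)[OF L] that show thesis by blast
qed

section \<open>Representing measures on the character space\<close>

lemma openin_character_evaluation:
  "open U \<Longrightarrow> openin character_topology {\<alpha> \<in> characters. \<alpha> a \<in> U}"
  unfolding character_topology_def by (rule topology_generated_by_Basis) blast

lemma topspace_character_topology: "topspace character_topology = characters"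
  unfolding character_topology_def topology_generated_by_topspace by blast

text \<open>The weak topology is the one inherited from pointwise convergence on all functions, so
  compactness and closedness of sets of characters become statements about the type class
  topology.\<close>

lemma character_topology_eq:
  "(character_topology :: ('a::real_algebra_1 \<Rightarrow> real) topology) = top_of_set characters"
proof -
  have "continuous_map (character_topology :: ('a \<Rightarrow> real) topology) (powertop_real UNIV) (\<lambda>\<alpha>. \<alpha>)"
    unfolding continuous_map_componentwise_UNIV
    by (auto simp: continuous_map_def topspace_character_topology openin_character_evaluation)
  then have 1: "continuous_map (character_topology :: ('a \<Rightarrow> real) topology) (top_of_set characters) id"
    by (simp add: continuous_map_in_subtopology euclidean_product_topology id_def topspace_character_topology)
  have 2: "continuous_map (top_of_set characters) (character_topology :: ('a \<Rightarrow> real) topology) id"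
    unfolding character_topology_def
  proof (rule continuous_on_generated_topo)
    fix V :: "('a \<Rightarrow> real) set" assume "V \<in> {{\<alpha> \<in> characters. \<alpha> a \<in> U} | a U. open U}"
    then obtain a :: 'a and U where V: "V = {\<alpha> \<in> characters. \<alpha> a \<in> U}" "open U" by blast
    have "id -` V \<inter> topspace (top_of_set characters) = characters \<inter> {h. h a \<in> U}"
      using V(1) by auto
    then show "openin (top_of_set characters) (id -` V \<inter> topspace (top_of_set characters))"
      using open_coordinate_preimage[OF V(2), of a] by (simp add: openin_open_Int)
  qed auto
  show ?thesis
    unfolding topology_eq
  proof (intro allI iffI)
    fix S :: "('a \<Rightarrow> real) set"
    show "openin (top_of_set characters) S" if "openin character_topology S"
    proof -
      have "S \<subseteq> characters" using openin_subset[OF that] by (simp add: topspace_character_topology)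
      then show ?thesis using openin_continuous_map_preimage[OF 2 that]
        by (simp add: Int_def[symmetric] Int_absorb1 Collect_conj_eq)
    qed
    show "openin character_topology S" if "openin (top_of_set characters) S"
    proof -
      have "S \<subseteq> characters" using openin_subset[OF that] by simp
      then show ?thesis using openin_continuous_map_preimage[OF 1 that]
        by (simp add: Int_absorb1 Collect_conj_eq topspace_character_topology)
    qed
  qed
qed

lemma compactin_character_topology:
  "compactin character_topology C \<longleftrightarrow> compact C \<and> C \<subseteq> characters"
  by (auto simp: character_topology_eq compactin_subtopology)

lemma closedin_character_topology_compact:
  assumes "compact C" "C \<subseteq> characters" shows "closedin character_topology C"
  using assms by (simp add: character_topology_eq closed_subset compact_imp_closed)

lemma Hausdorff_space_top_of_set: "Hausdorff_space (top_of_set (S :: 'a::t2_space set))"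
proof (rule Hausdorff_space_subtopology)
  show "Hausdorff_space (euclidean :: 'a topology)"
    unfolding Hausdorff_space_def disjnt_def using hausdorff by (metis open_openin)
qed

text \<open>On C the evaluations are closed under sums and products, since characters are
  multiplicative; multiples of the unit give the constants, and two distinct characters differ at
  some element. Stone-Weierstrass applies to the functions that agree with an evaluation on
  C.\<close>

lemma characters_dense:
  fixes C :: "('a::{real_algebra_1, comm_ring_1} \<Rightarrow> real) set"
  assumes C: "compact C" "C \<subseteq> characters" and f: "continuous_on C f" and e: "0 < e"
  obtains a where "\<And>\<alpha>. \<alpha> \<in> C \<Longrightarrow> \<bar>f \<alpha> - \<alpha> a\<bar> < e"
proof -
  have ch: "\<And>\<alpha> x y. \<alpha> \<in> C \<Longrightarrow> \<alpha> (x + y) = \<alpha> x + \<alpha> y"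
    "\<And>\<alpha> r x. \<alpha> \<in> C \<Longrightarrow> \<alpha> (r *\<^sub>R x) = r * \<alpha> x"
    "\<And>\<alpha> x y. \<alpha> \<in> C \<Longrightarrow> \<alpha> (x * y) = \<alpha> x * \<alpha> y" "\<And>\<alpha>. \<alpha> \<in> C \<Longrightarrow> \<alpha> 1 = 1"
    using C(2) by (auto simp: characters_def linear_iff subset_iff)
  interpret function_ring_on "{f. \<exists>a. \<forall>\<alpha>\<in>C. f \<alpha> = \<alpha> a}" C
  proof
    show "compact C" by fact
    show "continuous_on C f" if "f \<in> {f. \<exists>a. \<forall>\<alpha>\<in>C. f \<alpha> = \<alpha> a}" for f :: "('a \<Rightarrow> real) \<Rightarrow> real"
    proof -
      from that obtain a where "\<forall>\<alpha>\<in>C. f \<alpha> = \<alpha> a" by blast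
      then show ?thesis using continuous_on_eval[of C a] by (simp cong: continuous_on_cong)
    qed
    fix f g :: "('a \<Rightarrow> real) \<Rightarrow> real"
    assume "f \<in> {f. \<exists>a. \<forall>\<alpha>\<in>C. f \<alpha> = \<alpha> a}" "g \<in> {f. \<exists>a. \<forall>\<alpha>\<in>C. f \<alpha> = \<alpha> a}"
    then obtain a b where ab: "\<forall>\<alpha>\<in>C. f \<alpha> = \<alpha> a" "\<forall>\<alpha>\<in>C. g \<alpha> = \<alpha> b" by blast
    show "(\<lambda>\<alpha>. f \<alpha> + g \<alpha>) \<in> {f. \<exists>a. \<forall>\<alpha>\<in>C. f \<alpha> = \<alpha> a}"
      by (intro CollectI exI[of _ "a + b"]) (simp add: ab ch)
    show "(\<lambda>\<alpha>. f \<alpha> * g \<alpha>) \<in> {f. \<exists>a. \<forall>\<alpha>\<in>C. f \<alpha> = \<alpha> a}"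
      by (intro CollectI exI[of _ "a * b"]) (simp add: ab ch)
  next
    show "(\<lambda>_. c) \<in> {f. \<exists>a. \<forall>\<alpha>\<in>C. f \<alpha> = \<alpha> a}" for c
      by (intro CollectI exI[of _ "c *\<^sub>R 1"]) (simp add: ch)
  next
    fix \<alpha> \<beta> :: "'a \<Rightarrow> real" assume "\<alpha> \<noteq> \<beta>"
    then obtain x where "\<alpha> x \<noteq> \<beta> x" by auto
    then show "\<exists>f\<in>{f. \<exists>a. \<forall>\<alpha>\<in>C. f \<alpha> = \<alpha> a}. f \<alpha> \<noteq> f \<beta>"
      by (intro bexI[of _ "\<lambda>\<alpha>. \<alpha> x"]) auto
  qed
  from Stone_Weierstrass_basic[OF f e] show thesis using that by fastforce
qed

text \<open>The condition \<open>dominated\<close> is the form of positivity produced by minimising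
  over states: a lower bound for a on C is a lower bound for L a. It also contains that C is
  nonempty.\<close>

locale dominated_functional =
  fixes L :: "'a::{real_algebra_1, comm_ring_1} \<Rightarrow> real" and C :: "('a \<Rightarrow> real) set"
  assumes lin: "linear L" and one: "L 1 = 1"
    and C_compact: "compact C" and C_characters: "C \<subseteq> characters"
    and dominated: "\<And>a. \<exists>\<alpha>\<in>C. \<alpha> a \<le> L a"
begin

text \<open>An upper envelope: the infimum of L over the elements whose transforms majorise f on C.
  It needs no choice of approximants and no injectivity of the transform.\<close>

definition extension :: "(('a \<Rightarrow> real) \<Rightarrow> real) \<Rightarrow> real" where
  "extension f = Inf (L ` {a. \<forall>\<alpha>\<in>C. f \<alpha> \<le> \<alpha> a})"

lemma character_simps:
  assumes "\<alpha> \<in> C"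
  shows "\<alpha> (x + y) = \<alpha> x + \<alpha> y" "\<alpha> (x - y) = \<alpha> x - \<alpha> y" "\<alpha> (r *\<^sub>R x) = r * \<alpha> x" "\<alpha> 1 = 1"
proof -
  have "linear \<alpha>" using C_characters assms by (auto simp: characters_def)
  then show "\<alpha> (x + y) = \<alpha> x + \<alpha> y" "\<alpha> (x - y) = \<alpha> x - \<alpha> y" "\<alpha> (r *\<^sub>R x) = r * \<alpha> x"
    by (simp_all add: linear_add linear_diff linear_scale)
qed (use C_characters assms in \<open>auto simp: characters_def\<close>)

lemma functional_simps:
  "L (x + y) = L x + L y" "L (x - y) = L x - L y" "L (r *\<^sub>R x) = r * L x"
  using lin by (simp_all add: linear_add linear_diff linear_scale)

lemma functional_ge:
  assumes "\<And>\<alpha>. \<alpha> \<in> C \<Longrightarrow> r \<le> \<alpha> a"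
  shows "r \<le> L a"
  using dominated[of a] assms by force

text \<open>The element a + e 1 majorises f, and every majorant b satisfies b - a >= -e on C.
  Linearity and positivity of the extension are transferred from L through this estimate.\<close>

lemma extension_approx:
  assumes "\<And>\<alpha>. \<alpha> \<in> C \<Longrightarrow> \<bar>f \<alpha> - \<alpha> a\<bar> \<le> e"
  shows "\<bar>extension f - L a\<bar> \<le> e"
proof -
  let ?A = "{a. \<forall>\<alpha>\<in>C. f \<alpha> \<le> \<alpha> a}"
  have lower: "L a - e \<le> L b" if "b \<in> ?A" for b
  proof -
    have "- e \<le> L (b - a)"
    proof (rule functional_ge)
      fix \<alpha> assume "\<alpha> \<in> C"
      then show "- e \<le> \<alpha> (b - a)" using that assms[of \<alpha>] by (force simp: character_simps abs_le_iff)
    qed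
    then show ?thesis by (simp add: functional_simps)
  qed
  have mem: "a + e *\<^sub>R 1 \<in> ?A"
    using assms by (force simp: character_simps abs_le_iff)
  have "extension f \<le> L (a + e *\<^sub>R 1)"
    unfolding extension_def by (rule cINF_lower[OF bdd_belowI2 mem]) (rule lower)
  moreover have "L a - e \<le> extension f"
    unfolding extension_def by (rule cINF_greatest) (use mem lower in blast)+
  ultimately show ?thesis by (simp add: functional_simps one abs_le_iff)
qed

lemma extension_eval: "extension (\<lambda>\<alpha>. \<alpha> a) = L a"
  using extension_approx[of "\<lambda>\<alpha>. \<alpha> a" a 0] by simp

lemma approximable:
  assumes "continuous_on C f" "0 < e"
  obtains a where "\<And>\<alpha>. \<alpha> \<in> C \<Longrightarrow> \<bar>f \<alpha> - \<alpha> a\<bar> \<le> e"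
  using characters_dense[OF C_compact C_characters assms] by (metis less_imp_le)

lemma extension_add:
  assumes f: "continuous_on C f" and g: "continuous_on C g"
  shows "extension (\<lambda>x. f x + g x) = extension f + extension g"
proof -
  have "\<bar>extension (\<lambda>x. f x + g x) - (extension f + extension g)\<bar> \<le> 0 + e" if "0 < e" for e
  proof -
    \<comment> \<open>Approximating f and g costs e/4 each, and their sum is then approximated
      within e/2; the three errors add up to e.\<close>
    have e4: "0 < e / 4" using that by simp
    obtain a where a: "\<And>\<alpha>. \<alpha> \<in> C \<Longrightarrow> \<bar>f \<alpha> - \<alpha> a\<bar> \<le> e / 4"
      using approximable[OF f e4] by blast
    obtain b where b: "\<And>\<alpha>. \<alpha> \<in> C \<Longrightarrow> \<bar>g \<alpha> - \<alpha> b\<bar> \<le> e / 4"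
      using approximable[OF g e4] by blast
    have ab: "\<bar>f \<alpha> + g \<alpha> - \<alpha> (a + b)\<bar> \<le> e / 2" if "\<alpha> \<in> C" for \<alpha>
      using a[OF that] b[OF that] character_simps(1)[OF that, of a b] by linarith
    show ?thesis
      using extension_approx[of f a, OF a] extension_approx[of g b, OF b] extension_approx[of "\<lambda>\<alpha>. f \<alpha> + g \<alpha>" "a + b", OF ab]
        functional_simps(1)[of a b] by linarith
  qed
  then have "\<bar>extension (\<lambda>x. f x + g x) - (extension f + extension g)\<bar> \<le> 0"
    by (rule field_le_epsilon)
  then show ?thesis by simp
qed

lemma extension_scale:
  assumes f: "continuous_on C f"
  shows "extension (\<lambda>x. c * f x) = c * extension f"
proof -
  have "\<bar>extension (\<lambda>x. c * f x) - c * extension f\<bar> \<le> 0 + e" if "0 < e" for e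
  proof -
    define d where "d = e / (2 * (\<bar>c\<bar> + 1))"
    have d: "0 < d" using that by (simp add: d_def)
    have "\<bar>c\<bar> * d \<le> (\<bar>c\<bar> + 1) * d" using d by (intro mult_right_mono) auto
    also have "\<dots> = e / 2" by (simp add: d_def field_simps)
    finally have cd: "\<bar>c\<bar> * d \<le> e / 2" .
    obtain a where a: "\<And>\<alpha>. \<alpha> \<in> C \<Longrightarrow> \<bar>f \<alpha> - \<alpha> a\<bar> \<le> d"
      using approximable[OF f d] by blast
    have ca: "\<bar>c * f \<alpha> - \<alpha> (c *\<^sub>R a)\<bar> \<le> e / 2" if "\<alpha> \<in> C" for \<alpha>
    proof -
      have "\<bar>c * f \<alpha> - \<alpha> (c *\<^sub>R a)\<bar> = \<bar>c\<bar> * \<bar>f \<alpha> - \<alpha> a\<bar>"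
        by (simp add: character_simps[OF that] flip: abs_mult right_diff_distrib)
      also have "\<dots> \<le> \<bar>c\<bar> * d" using a[OF that] by (intro mult_left_mono) auto
      finally show ?thesis using cd by simp
    qed
    have "\<bar>c * extension f - c * L a\<bar> = \<bar>c\<bar> * \<bar>extension f - L a\<bar>"
      by (simp flip: abs_mult right_diff_distrib)
    also have "\<dots> \<le> \<bar>c\<bar> * d" using extension_approx[OF a] by (intro mult_left_mono) auto
    finally have "\<bar>c * extension f - c * L a\<bar> \<le> e / 2" using cd by simp
    with extension_approx[of "\<lambda>\<alpha>. c * f \<alpha>" "c *\<^sub>R a", OF ca] show ?thesis
      using functional_simps(3)[of c a] by linarith
  qed
  then have "\<bar>extension (\<lambda>x. c * f x) - c * extension f\<bar> \<le> 0"
    by (rule field_le_epsilon)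
  then show ?thesis by simp
qed

lemma extension_nonneg:
  assumes f: "continuous_on C f" and pos: "\<And>\<alpha>. \<alpha> \<in> C \<Longrightarrow> 0 \<le> f \<alpha>"
  shows "0 \<le> extension f"
proof (rule field_le_epsilon)
  fix e :: real assume e: "0 < e"
  obtain a where a: "\<And>\<alpha>. \<alpha> \<in> C \<Longrightarrow> \<bar>f \<alpha> - \<alpha> a\<bar> \<le> e / 2"
    using approximable[OF f half_gt_zero[OF e]] by blast
  have "- (e / 2) \<le> L a"
  proof (rule functional_ge)
    fix \<alpha> assume "\<alpha> \<in> C"
    from a[OF this] pos[OF this] show "- (e / 2) \<le> \<alpha> a" by linarith
  qed
  with extension_approx[of f a, OF a] show "0 \<le> extension f + e" by linarith
qed

sublocale ext: positive_functional "top_of_set C" extension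
proof
  show "compact_space (top_of_set C)" using C_compact by (simp add: compact_space_subtopology)
  show "Hausdorff_space (top_of_set C)" by (rule Hausdorff_space_top_of_set)
qed (auto intro: extension_add extension_scale extension_nonneg)

text \<open>The Riesz measure lives on the subspace C; pushing it forward along the inclusion gives
  a Borel measure on the whole character space.\<close>

definition representing_measure :: "('a \<Rightarrow> real) measure" where
  "representing_measure =
     distr ext.riesz (sigma characters {U. openin character_topology U}) (\<lambda>\<alpha>. \<alpha>)"

lemmas opens_characters = openin_Pow[of character_topology, unfolded topspace_character_topology]

lemma measurable_inclusion:
  "(\<lambda>\<alpha>. \<alpha>) \<in> measurable ext.riesz (sigma characters {U. openin character_topology U})"
proof (rule measurable_measure_of[OF opens_characters])
  show "(\<lambda>\<alpha>. \<alpha>) \<in> space ext.riesz \<rightarrow> characters" using C_characters by auto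
  fix U :: "('a \<Rightarrow> real) set" assume "U \<in> {U. openin character_topology U}"
  then obtain W where "open W" "U = characters \<inter> W"
    by (auto simp: character_topology_eq openin_open)
  then have "(\<lambda>\<alpha>. \<alpha>) -` U \<inter> space ext.riesz = C \<inter> W" using C_characters by auto
  then show "(\<lambda>\<alpha>. \<alpha>) -` U \<inter> space ext.riesz \<in> sets ext.riesz"
    using \<open>open W\<close> by (auto intro!: ext.openin_sets_riesz openin_open_Int)
qed

lemma sets_representing_measure:
  "sets representing_measure = sigma_sets characters {U. openin character_topology U}"
  by (simp add: representing_measure_def sets_measure_of[OF opens_characters])

lemma emeasure_representing_measure:
  assumes "E \<in> sets representing_measure"
  shows "emeasure representing_measure E = emeasure ext.riesz (E \<inter> C)" "E \<inter> C \<in> sets ext.riesz"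
proof -
  have E: "E \<in> sets (sigma characters {U. openin character_topology U})"
    using assms by (simp add: representing_measure_def)
  show "emeasure representing_measure E = emeasure ext.riesz (E \<inter> C)"
    unfolding representing_measure_def using emeasure_distr[OF measurable_inclusion E] by simp
  show "E \<inter> C \<in> sets ext.riesz"
    using measurable_sets[OF measurable_inclusion E] by simp
qed

lemma radon_representing_measure: "radon_measure character_topology representing_measure"
  unfolding radon_measure_def
proof (intro conjI ballI)
  show sets_eq: "sets representing_measure =
      sets (sigma (topspace character_topology) {U. openin character_topology U})"
    by (simp add: representing_measure_def topspace_character_topology)
  interpret R: finite_measure ext.riesz by (rule ext.finite_measure_riesz)
  show "\<exists>U. openin character_topology U \<and> x \<in> U \<and> emeasure representing_measure U < \<infinity>"
    if "x \<in> topspace character_topology" for x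
  proof (intro exI[of _ characters] conjI)
    show "openin character_topology (characters :: ('a \<Rightarrow> real) set)"
      using openin_topspace[of "character_topology :: ('a \<Rightarrow> real) topology"] by (simp add: topspace_character_topology)
    then have "characters \<in> sets representing_measure" by (simp add: sets_representing_measure sigma_sets.Basic)
    then show "emeasure representing_measure characters < \<infinity>"
      by (simp add: emeasure_representing_measure less_top[symmetric])
    show "x \<in> characters" using that by (simp add: topspace_character_topology)
  qed
  fix E assume E: "E \<in> sets representing_measure"
  show "emeasure representing_measure E =
      (SUP K\<in>{K. compactin character_topology K \<and> K \<subseteq> E}. emeasure representing_measure K)"
  proof (rule antisym)
    show "(SUP K\<in>{K. compactin character_topology K \<and> K \<subseteq> E}. emeasure representing_measure K)
        \<le> emeasure representing_measure E"
      by (rule SUP_least) (use E in \<open>auto intro: emeasure_mono\<close>)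
    show "emeasure representing_measure E
        \<le> (SUP K\<in>{K. compactin character_topology K \<and> K \<subseteq> E}. emeasure representing_measure K)"
    proof (rule ennreal_le_epsilon)
      fix e :: real assume e: "0 < e"
      obtain Q where Q: "closedin (top_of_set C) Q" "Q \<subseteq> E \<inter> C"
        "emeasure ext.riesz (E \<inter> C) \<le> emeasure ext.riesz Q + ennreal e"
        by (rule ext.riesz_inner_approx[OF emeasure_representing_measure(2)[OF E] e])
      have Qc: "compact Q" using Q(1) C_compact closedin_compact by blast
      have Qch: "Q \<subseteq> characters" using Q(2) C_characters by blast
      \<comment> \<open>The set Q comes from the subspace C; being compact, it is also closed among
        all characters, hence measurable there.\<close>
      have "characters - Q \<in> sets representing_measure"
        using closedin_character_topology_compact[OF Qc Qch]
        by (simp add: sets_representing_measure sigma_sets.Basic closedin_def topspace_character_topology)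
      then have "characters - (characters - Q) \<in> sets representing_measure"
        using sets.compl_sets[of _ representing_measure]
        by (simp add: representing_measure_def space_measure_of[OF opens_characters])
      then have "Q \<in> sets representing_measure" using Qch by (simp add: double_diff)
      then have "emeasure representing_measure Q = emeasure ext.riesz Q"
        using Q(2) by (simp add: emeasure_representing_measure Int_absorb2)
      moreover have "emeasure representing_measure Q \<le>
          (SUP K\<in>{K. compactin character_topology K \<and> K \<subseteq> E}. emeasure representing_measure K)"
        using Qc Qch Q(2) by (intro SUP_upper) (auto simp: compactin_character_topology)
      ultimately show "emeasure representing_measure E \<le>
          (SUP K\<in>{K. compactin character_topology K \<and> K \<subseteq> E}. emeasure representing_measure K) + ennreal e"
        using Q(3) emeasure_representing_measure(1)[OF E] by (metis add_right_mono order_trans)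
    qed
  qed
qed

lemma represents_representing_measure: "represents representing_measure L"
  unfolding represents_def
proof
  fix a :: 'a
  have "(\<lambda>\<alpha> :: 'a \<Rightarrow> real. \<alpha> a) \<in>
      borel_measurable (sigma characters {U. openin character_topology U})"
  proof (rule borel_measurableI)
    fix S :: "real set" assume "open S"
    then have "openin character_topology ((\<lambda>\<alpha>. \<alpha> a) -` S \<inter> characters)"
      using openin_character_evaluation[of S a] by (simp add: vimage_def Int_def conj_commute)
    then show "(\<lambda>\<alpha>. \<alpha> a) -` S \<inter> space (sigma characters {U. openin character_topology U})
        \<in> sets (sigma characters {U. openin character_topology U})"
      by (simp add: space_measure_of[OF opens_characters] sets_measure_of[OF opens_characters])
  qed
  moreover have "has_bochner_integral ext.riesz (\<lambda>\<alpha>. \<alpha> a) (L a)"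
    using ext.Riesz_representation[of "\<lambda>\<alpha>. \<alpha> a"] by (simp add: continuous_on_eval extension_eval)
  ultimately show "has_bochner_integral representing_measure (\<lambda>\<alpha>. \<alpha> a) (L a)"
    unfolding representing_measure_def
    using measurable_inclusion by (intro has_bochner_integral_distr)
qed

lemma representing_measure_null: "emeasure representing_measure (characters - C) = 0"
proof -
  have "openin character_topology (characters - C)"
    using closedin_character_topology_compact[OF C_compact C_characters]
    by (simp add: closedin_def topspace_character_topology)
  then have "characters - C \<in> sets representing_measure" by (simp add: sets_representing_measure sigma_sets.Basic)
  moreover have "(characters - C) \<inter> C = {}" by blast
  ultimately show ?thesis by (simp add: emeasure_representing_measure)
qed

end

section \<open>Supports, existence and uniqueness\<close>

lemma radon_measure_openin_sets:
  "radon_measure T \<nu> \<Longrightarrow> openin T U \<Longrightarrow> U \<in> sets \<nu>"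
  by (simp add: radon_measure_def sets_measure_of[OF openin_Pow] sigma_sets.Basic)

lemma radon_measure_space: "radon_measure T \<nu> \<Longrightarrow> space \<nu> = topspace T"
  using sets_eq_imp_space_eq[of \<nu> "sigma (topspace T) {U. openin T U}"]
  by (simp add: radon_measure_def space_measure_of[OF openin_Pow])

lemma radon_measure_closedin_sets:
  assumes "radon_measure T \<nu>" "closedin T C" shows "C \<in> sets \<nu>"
proof -
  have "space \<nu> - (topspace T - C) \<in> sets \<nu>"
    using assms by (intro sets.compl_sets radon_measure_openin_sets) auto
  then show ?thesis
    using closedin_subset[OF assms(2)] by (simp add: radon_measure_space[OF assms(1)] double_diff)
qed

text \<open>The candidate is the complement of the union W of all null open sets. This union may be
  uncountable, but a compact subset of W meets only finitely many members of a finite subcover and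
  is null; inner regularity then makes W null.\<close>

lemma radon_measure_support:
  assumes \<nu>: "radon_measure T \<nu>"
  shows closedin_support: "closedin T (support T \<nu>)"
    and support_null: "emeasure \<nu> (topspace T - support T \<nu>) = 0"
    and support_subset: "\<And>C. closedin T C \<Longrightarrow> emeasure \<nu> (topspace T - C) = 0 \<Longrightarrow> support T \<nu> \<subseteq> C"
proof -
  define W where "W = \<Union>{U. openin T U \<and> emeasure \<nu> U = 0}"
  have oW: "openin T W" by (auto simp: W_def)
  then have cW: "closedin T (topspace T - W)" by blast
  have "emeasure \<nu> K = 0" if K: "compactin T K" "K \<subseteq> W" for K
  proof -
    obtain \<F> where \<F>: "finite \<F>" "\<F> \<subseteq> {U. openin T U \<and> emeasure \<nu> U = 0}" "K \<subseteq> \<Union>\<F>"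
      using compactinD[OF K(1), of "{U. openin T U \<and> emeasure \<nu> U = 0}"] K(2) by (auto simp: W_def)
    have "\<Union>\<F> \<in> null_sets \<nu>"
      using \<F>(1,2) radon_measure_openin_sets[OF \<nu>] by (intro null_sets.finite_Union) (auto intro: null_setsI)
    then have "emeasure \<nu> K \<le> 0"
      using emeasure_mono[OF \<F>(3), of \<nu>] null_setsD1 null_setsD2 by metis
    then show ?thesis by simp
  qed
  then have nW: "emeasure \<nu> W = 0"
  proof -
    have "emeasure \<nu> W = (SUP K\<in>{K. compactin T K \<and> K \<subseteq> W}. emeasure \<nu> K)"
      using \<nu> radon_measure_openin_sets[OF \<nu> oW] unfolding radon_measure_def by blast
    also have "\<dots> \<le> 0"
      by (rule SUP_least) (simp add: \<open>\<And>K. compactin T K \<Longrightarrow> K \<subseteq> W \<Longrightarrow> emeasure \<nu> K = 0\<close>)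
    finally show ?thesis by simp
  qed
  have "support T \<nu> = topspace T - W"
    unfolding support_def
  proof (rule Least_equality)
    show "closedin T (topspace T - W) \<and> emeasure \<nu> (topspace T - (topspace T - W)) = 0"
      using cW nW openin_subset[OF oW] by (simp add: double_diff)
    show "topspace T - W \<subseteq> C" if "closedin T C \<and> emeasure \<nu> (topspace T - C) = 0" for C
      using that by (auto simp: W_def closedin_def)
  qed
  moreover have "topspace T - W \<subseteq> C" if "closedin T C" "emeasure \<nu> (topspace T - C) = 0" for C
    using that by (auto simp: W_def closedin_def)
  ultimately show "closedin T (support T \<nu>)" "emeasure \<nu> (topspace T - support T \<nu>) = 0"
    "\<And>C. closedin T C \<Longrightarrow> emeasure \<nu> (topspace T - C) = 0 \<Longrightarrow> support T \<nu> \<subseteq> C"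
    using cW nW openin_subset[OF oW] by (auto simp: double_diff)
qed

lemma exists_representing_measure:
  fixes L :: "'a::{real_algebra_1, comm_ring_1} \<Rightarrow> real"
  assumes L: "square_positive L" and one: "L 1 = 1" and bounded: "bounded_elements L = UNIV"
  shows "\<exists>\<nu>. radon_measure character_topology \<nu> \<and> represents \<nu> L \<and>
             compactin character_topology (support character_topology \<nu>)"
proof -
  have "\<forall>a. \<exists>K\<ge>0. \<forall>c. L (a ^ 2 * c ^ 2) \<le> K * L (c ^ 2)"
    using bounded by (auto simp: bounded_elements_def)
  then obtain K where K: "\<And>a. 0 \<le> K a" "\<And>a c. L (a ^ 2 * c ^ 2) \<le> K a * L (c ^ 2)"
    by metis
  have LK: "L \<in> states K"
    using L one K by (simp add: states_def square_positive_def)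
  let ?C = "characters \<inter> states K"
  have "compact ?C"
    using compact_Int_closed[OF compact_states closed_characters] by (simp add: Int_commute)
  moreover have "\<exists>\<alpha>\<in>?C. \<alpha> a \<le> L a" for a
    using state_le_characters[OF LK K(1), of a] by blast
  ultimately interpret dominated_functional L ?C
    using L one by (simp add: dominated_functional_def square_positive_def)
  have "support character_topology representing_measure \<subseteq> ?C"
    by (rule support_subset[OF radon_representing_measure
          closedin_character_topology_compact[OF C_compact C_characters]])
      (simp only: topspace_character_topology representing_measure_null)
  then have "compactin character_topology (support character_topology representing_measure)"
    using closed_compactin[OF _ _ closedin_support[OF radon_representing_measure]]
      C_compact C_characters by (metis compactin_character_topology)
  then show ?thesis
    using radon_representing_measure represents_representing_measure by blast
qed

text \<open>Evaluation at the unit is constantly 1 on characters, so L(1) = 1 is the total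
  mass.\<close>

lemma represents_prob_space:
  fixes L :: "'a::{real_algebra_1, comm_ring_1} \<Rightarrow> real"
  assumes \<nu>: "radon_measure character_topology \<nu>" and rep: "represents \<nu> L" and one: "L 1 = 1"
  shows "finite_measure \<nu>" "measure \<nu> characters = 1"
proof -
  have sp: "space \<nu> = characters"
    using radon_measure_space[OF \<nu>] by (simp add: topspace_character_topology)
  have "has_bochner_integral \<nu> (\<lambda>\<alpha>. \<alpha> 1) 1" using rep[unfolded represents_def, rule_format, of 1] one by simp
  moreover have "has_bochner_integral \<nu> (\<lambda>\<alpha>. \<alpha> 1) 1 = has_bochner_integral \<nu> (\<lambda>_. 1 :: real) 1"
    by (rule has_bochner_integral_cong) (auto simp: sp characters_def)
  ultimately have b: "has_bochner_integral \<nu> (\<lambda>_. 1 :: real) 1" by blast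
  then have "emeasure \<nu> (space \<nu>) < \<infinity>"
    using has_bochner_integral_iff[of \<nu> "\<lambda>_. 1 :: real"] by (simp add: integrable_iff_bounded)
  then show "finite_measure \<nu>" by (intro finite_measureI) auto
  show "measure \<nu> characters = 1"
    using has_bochner_integral_integral_eq[OF b] by (simp add: sp)
qed

text \<open>Choose a compact Q' that nearly exhausts the complement of Q for \<mu>, and a continuous
  g with g = 1 on Q and g = 0 on Q'. An evaluation at some a approximates g on a compact set
  carrying both measures. Both integrals of this evaluation equal L a, which lies above the
  \<nu>-measure of Q and below the \<mu>-measure of the complement of Q', up to errors.\<close>

lemma represents_measure_compact_le:
  fixes L :: "'a::{real_algebra_1, comm_ring_1} \<Rightarrow> real"
  assumes one: "L 1 = 1"
    and \<nu>: "radon_measure character_topology \<nu>" "represents \<nu> L"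
      "compactin character_topology (support character_topology \<nu>)"
    and \<mu>: "radon_measure character_topology \<mu>" "represents \<mu> L"
      "compactin character_topology (support character_topology \<mu>)"
    and Q: "compactin character_topology Q"
  shows "measure \<nu> Q \<le> measure \<mu> Q"
proof (rule field_le_epsilon)
  fix d :: real assume d: "0 < d"
  \<comment> \<open>One error comes from the choice of Q' and one from each of the two uses of the
    approximation of g.\<close>
  define e where "e = d / 3"
  have e: "0 < e" using d by (simp add: e_def)
  interpret N: finite_measure \<nu> by (rule represents_prob_space[OF \<nu>(1,2) one])
  interpret M: finite_measure \<mu> by (rule represents_prob_space[OF \<mu>(1,2) one])
  note prob = represents_prob_space(2)[OF \<nu>(1,2) one] represents_prob_space(2)[OF \<mu>(1,2) one]
  have spN: "space \<nu> = characters" and spM: "space \<mu> = characters"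
    using radon_measure_space[OF \<nu>(1)] radon_measure_space[OF \<mu>(1)]
    by (simp_all add: topspace_character_topology)
  have meas: "C \<in> sets \<nu>" "C \<in> sets \<mu>" if "compactin character_topology C" for C
    using that \<nu>(1) \<mu>(1)
    by (auto intro!: radon_measure_closedin_sets closedin_character_topology_compact
        simp: compactin_character_topology)
  have QM: "characters - Q \<in> sets \<mu>" using sets.compl_sets[OF meas(2)[OF Q]] by (simp add: spM)
  have Qch: "Q \<subseteq> characters" using Q by (simp add: compactin_character_topology)
  obtain Q' where Q': "compactin character_topology Q'" "Q' \<subseteq> characters - Q"
    "measure \<mu> (characters - Q) - e \<le> measure \<mu> Q'"
  proof (cases "measure \<mu> (characters - Q) < e")
    case True
    then show thesis using that[of "{}"] by simp
  next
    case False
    have "ennreal (measure \<mu> (characters - Q) - e) < emeasure \<mu> (characters - Q)"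
      using False e by (simp add: M.emeasure_eq_measure ennreal_less_iff)
    also have "\<dots> = (SUP K\<in>{K. compactin character_topology K \<and> K \<subseteq> characters - Q}. emeasure \<mu> K)"
      using \<mu>(1) QM unfolding radon_measure_def by blast
    finally obtain K where K: "compactin character_topology K" "K \<subseteq> characters - Q"
      "ennreal (measure \<mu> (characters - Q) - e) < emeasure \<mu> K"
      unfolding less_SUP_iff by blast
    then show thesis
      using that[of K] False by (simp add: M.emeasure_eq_measure ennreal_less_iff)
  qed
  \<comment> \<open>Including Q and Q' places the Urysohn construction inside D; including both
    supports makes the complement of D null for both measures.\<close>
  define D where "D = support character_topology \<nu> \<union> support character_topology \<mu> \<union> Q \<union> Q'"
  have Dc: "compactin character_topology D"
    unfolding D_def using \<nu>(3) \<mu>(3) Q Q'(1) by (intro compactin_Un)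
  then have D: "compact D" "D \<subseteq> characters" by (auto simp: compactin_character_topology)
  obtain g where g: "continuous_map (top_of_set D) euclideanreal g"
    "\<And>x. x \<in> D \<Longrightarrow> 0 \<le> g x \<and> g x \<le> 1" "\<And>x. x \<in> Q' \<Longrightarrow> g x = 0" "\<And>x. x \<in> Q \<Longrightarrow> g x = 1"
  proof (rule Urysohn_unit_interval[of "top_of_set D" Q' Q])
    show "compact_space (top_of_set D)" using D(1) by (simp add: compact_space_subtopology)
    show "Hausdorff_space (top_of_set D)" by (rule Hausdorff_space_top_of_set)
    show "closedin (top_of_set D) Q'" "closedin (top_of_set D) Q"
      using Q Q'(1)
      by (auto intro!: closed_subset compact_imp_closed simp: D_def compactin_character_topology)
    show "Q' \<inter> Q = {}" using Q'(2) by blast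
  qed auto
  obtain a where a: "\<And>\<alpha>. \<alpha> \<in> D \<Longrightarrow> \<bar>g \<alpha> - \<alpha> a\<bar> < e"
    using characters_dense[OF D _ e, of g] g(1) by auto
  have nullN: "AE \<alpha> in \<nu>. \<alpha> \<in> D"
  proof (rule AE_I)
    show "{x \<in> space \<nu>. x \<notin> D} \<subseteq> characters - support character_topology \<nu>"
      by (auto simp: spN D_def)
    show "emeasure \<nu> (characters - support character_topology \<nu>) = 0"
      using support_null[OF \<nu>(1)] by (simp add: topspace_character_topology)
    show "characters - support character_topology \<nu> \<in> sets \<nu>"
      using sets.compl_sets[OF meas(1)[OF \<nu>(3)]] by (simp add: spN)
  qed
  have nullM: "AE \<alpha> in \<mu>. \<alpha> \<in> D"
  proof (rule AE_I)
    show "{x \<in> space \<mu>. x \<notin> D} \<subseteq> characters - support character_topology \<mu>"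
      by (auto simp: spM D_def)
    show "emeasure \<mu> (characters - support character_topology \<mu>) = 0"
      using support_null[OF \<mu>(1)] by (simp add: topspace_character_topology)
    show "characters - support character_topology \<mu> \<in> sets \<mu>"
      using sets.compl_sets[OF meas(2)[OF \<mu>(3)]] by (simp add: spM)
  qed
  have iN: "integrable \<nu> (\<lambda>\<alpha>. \<alpha> a)" "(\<integral>\<alpha>. \<alpha> a \<partial>\<nu>) = L a"
    using \<nu>(2) by (auto simp: represents_def has_bochner_integral_iff)
  have iM: "integrable \<mu> (\<lambda>\<alpha>. \<alpha> a)" "(\<integral>\<alpha>. \<alpha> a \<partial>\<mu>) = L a"
    using \<mu>(2) by (auto simp: represents_def has_bochner_integral_iff)
  have Q'M: "characters - Q' \<in> sets \<mu>" using sets.compl_sets[OF meas(2)[OF Q'(1)]] by (simp add: spM)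
  have "measure \<nu> Q = (\<integral>\<alpha>. indicator Q \<alpha> \<partial>\<nu>)"
    using Qch by (simp add: spN Int_absorb2)
  also have "\<dots> \<le> (\<integral>\<alpha>. \<alpha> a + e \<partial>\<nu>)"
  proof (rule integral_mono_AE)
    show "integrable \<nu> (indicator Q :: _ \<Rightarrow> real)"
      using meas(1)[OF Q] by (intro integrable_real_indicator) (auto simp: less_top[symmetric])
    show "integrable \<nu> (\<lambda>\<alpha>. \<alpha> a + e)" using iN(1) by simp
    show "AE \<alpha> in \<nu>. indicator Q \<alpha> \<le> \<alpha> a + e"
      using nullN
    proof (eventually_elim)
      case (elim \<alpha>)
      then show ?case using a[OF elim] g(2)[OF elim] g(4)[of \<alpha>]
        by (cases "\<alpha> \<in> Q") (auto simp: abs_less_iff)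
    qed
  qed
  also have "\<dots> = L a + e"
    using iN prob(1) by (simp add: spN)
  also have "L a = (\<integral>\<alpha>. \<alpha> a \<partial>\<mu>)" by (simp add: iM)
  also have "\<dots> \<le> (\<integral>\<alpha>. indicator (characters - Q') \<alpha> + e \<partial>\<mu>)"
  proof (rule integral_mono_AE)
    have i: "integrable \<mu> (indicator (characters - Q') :: _ \<Rightarrow> real)"
      using Q'M by (intro integrable_real_indicator) (auto simp: less_top[symmetric])
    then show "integrable \<mu> (\<lambda>\<alpha>. indicator (characters - Q') \<alpha> + e)" by simp
    show "integrable \<mu> (\<lambda>\<alpha>. \<alpha> a)" by (rule iM)
    show "AE \<alpha> in \<mu>. \<alpha> a \<le> indicator (characters - Q') \<alpha> + e"
      using nullM
    proof (eventually_elim)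
      case (elim \<alpha>)
      moreover have "\<alpha> \<in> characters" using elim D(2) by blast
      ultimately show ?case using a[OF elim] g(2)[OF elim] g(3)[of \<alpha>]
        by (cases "\<alpha> \<in> Q'") (auto simp: abs_less_iff)
    qed
  qed
  also have "\<dots> = measure \<mu> (characters - Q') + e"
  proof -
    have i: "integrable \<mu> (indicator (characters - Q') :: _ \<Rightarrow> real)"
      using Q'M by (intro integrable_real_indicator) (auto simp: less_top[symmetric])
    have "(characters - Q') \<inter> characters = characters - Q'" by blast
    then show ?thesis
      using i prob(2) by (subst Bochner_Integration.integral_add) (auto simp: spM)
  qed
  also have "measure \<mu> (characters - Q') = measure \<mu> characters - measure \<mu> Q'"
    using M.finite_measure_compl[OF meas(2)[OF Q'(1)]] by (simp add: spM)
  finally have "measure \<nu> Q \<le> measure \<mu> characters - measure \<mu> Q' + e + e" by simp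
  moreover have "measure \<mu> (characters - Q) = measure \<mu> characters - measure \<mu> Q"
    using M.finite_measure_compl[OF meas(2)[OF Q]] by (simp add: spM)
  ultimately show "measure \<nu> Q \<le> measure \<mu> Q + d" using Q'(3) by (simp add: e_def)
qed

text \<open>The comparison on compact sets is symmetric in the two measures, and inner regularity
  carries equality to all Borel sets.\<close>

lemma representing_measure_unique:
  fixes L :: "'a::{real_algebra_1, comm_ring_1} \<Rightarrow> real"
  assumes one: "L 1 = 1"
    and \<nu>: "radon_measure character_topology \<nu>" "represents \<nu> L"
      "compactin character_topology (support character_topology \<nu>)"
    and \<mu>: "radon_measure character_topology \<mu>" "represents \<mu> L"
      "compactin character_topology (support character_topology \<mu>)"
  shows "\<nu> = \<mu>"
proof (rule measure_eqI)
  interpret N: finite_measure \<nu> by (rule represents_prob_space[OF \<nu>(1,2) one])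
  interpret M: finite_measure \<mu> by (rule represents_prob_space[OF \<mu>(1,2) one])
  show sets: "sets \<nu> = sets \<mu>" using \<nu>(1) \<mu>(1) by (simp add: radon_measure_def)
  fix E assume E: "E \<in> sets \<nu>"
  have "emeasure \<nu> E = (SUP K\<in>{K. compactin character_topology K \<and> K \<subseteq> E}. emeasure \<nu> K)"
    using \<nu>(1) E unfolding radon_measure_def by blast
  also have "\<dots> = (SUP K\<in>{K. compactin character_topology K \<and> K \<subseteq> E}. emeasure \<mu> K)"
  proof (rule SUP_cong[OF refl])
    fix K assume "K \<in> {K. compactin character_topology K \<and> K \<subseteq> E}"
    then show "emeasure \<nu> K = emeasure \<mu> K"
      using represents_measure_compact_le[OF one \<nu> \<mu>, of K] represents_measure_compact_le[OF one \<mu> \<nu>, of K]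
      by (simp add: N.emeasure_eq_measure M.emeasure_eq_measure)
  qed
  also have "\<dots> = emeasure \<mu> E"
    using \<mu>(1) E unfolding sets radon_measure_def by (metis (no_types, lifting))
  finally show "emeasure \<nu> E = emeasure \<mu> E" .
qed

lemma support_representing_measure:
  fixes L :: "'a::{real_algebra_1, comm_ring_1} \<Rightarrow> real"
  assumes \<nu>: "radon_measure character_topology \<nu>" and rep: "represents \<nu> L" and one: "L 1 = 1"
    and p: "0 \<le> p" and bound: "\<And>n. 1 \<le> n \<Longrightarrow> L (b ^ (2 * n)) \<le> p ^ (2 * n)"
  shows "support character_topology \<nu> \<subseteq> {\<alpha> \<in> characters. \<bar>\<alpha> b\<bar> \<le> p}"
proof (rule support_subset[OF \<nu>])
  interpret finite_measure \<nu> by (rule represents_prob_space[OF \<nu> rep one])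
  have sp: "space \<nu> = characters"
    using radon_measure_space[OF \<nu>] by (simp add: topspace_character_topology)
  have closed: "closedin character_topology {\<alpha> \<in> characters. \<bar>\<alpha> b\<bar> \<le> r}" for r
  proof -
    have "closed {\<alpha> :: 'a \<Rightarrow> real. \<bar>\<alpha> b\<bar> \<le> r}"
      by (intro closed_Collect_le continuous_intros continuous_on_eval)
    then show ?thesis
      unfolding character_topology_eq closedin_closed by (intro exI conjI) auto
  qed
  then show "closedin character_topology {\<alpha> \<in> characters. \<bar>\<alpha> b\<bar> \<le> p}" .
  have ev: "(\<lambda>\<alpha>. \<alpha> b) \<in> borel_measurable \<nu>"
    using rep by (auto simp: represents_def dest: has_bochner_integral_iff[THEN iffD1])
  define U where "U r = {\<alpha> \<in> space \<nu>. r \<le> \<bar>\<alpha> b\<bar>}" for r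
  have U: "U r \<in> sets \<nu>" for r unfolding U_def using ev by measurable
  have null: "measure \<nu> (U r) = 0" if r: "p < r" for r
  proof (rule ccontr)
    assume "measure \<nu> (U r) \<noteq> 0"
    then have m: "0 < measure \<nu> (U r)" by (simp add: zero_less_measure_iff)
    have r0: "0 < r" using r p by simp
    have q: "0 \<le> p / r" "p / r < 1" using r r0 p by auto
    obtain n where n: "(p / r) ^ n < measure \<nu> (U r)"
      using real_arch_pow_inv[OF m q(2)] by blast
    \<comment> \<open>The moment bound is available for exponents with n >= 1 only; the larger
      exponent 2 (n + 1) is harmless because p/r < 1.\<close>
    let ?n = "Suc n"
    have b: "has_bochner_integral \<nu> (\<lambda>\<alpha>. \<alpha> (b ^ (2 * ?n))) (L (b ^ (2 * ?n)))"
      using rep by (simp add: represents_def)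
    have pow: "\<alpha> (b ^ k) = \<alpha> b ^ k" if "\<alpha> \<in> characters" for \<alpha> :: "'a \<Rightarrow> real" and k
      using that by (induction k) (auto simp: characters_def)
    have "r ^ (2 * ?n) * measure \<nu> (U r) = (\<integral>\<alpha>. r ^ (2 * ?n) * indicator (U r) \<alpha> \<partial>\<nu>)"
      using U sets.sets_into_space[OF U] by (simp add: Int_absorb2)
    also have "\<dots> \<le> (\<integral>\<alpha>. \<alpha> (b ^ (2 * ?n)) \<partial>\<nu>)"
    proof (rule integral_mono)
      show "integrable \<nu> (\<lambda>\<alpha>. r ^ (2 * ?n) * indicator (U r) \<alpha>)"
        using U by (intro integrable_mult_right integrable_real_indicator) (auto simp: less_top[symmetric])
      show "integrable \<nu> (\<lambda>\<alpha>. \<alpha> (b ^ (2 * ?n)))" using b by (simp add: has_bochner_integral_iff)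
      fix \<alpha> assume \<alpha>: "\<alpha> \<in> space \<nu>"
      have eq: "\<alpha> (b ^ (2 * ?n)) = \<bar>\<alpha> b\<bar> ^ (2 * ?n)"
        using \<alpha> power_even_abs[of "2 * ?n" "\<alpha> b"] by (simp only: sp pow even_mult_iff even_numeral simp_thms)
      show "r ^ (2 * ?n) * indicator (U r) \<alpha> \<le> \<alpha> (b ^ (2 * ?n))"
      proof (cases "\<alpha> \<in> U r")
        case True
        then have "r ^ (2 * ?n) \<le> \<bar>\<alpha> b\<bar> ^ (2 * ?n)"
          using r0 by (intro power_mono) (auto simp: U_def)
        then show ?thesis unfolding eq using True by simp
      next
        case False
        then show ?thesis unfolding eq by simp
      qed
    qed
    also have "\<dots> = L (b ^ (2 * ?n))" using b by (rule has_bochner_integral_integral_eq)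
    also have "\<dots> \<le> p ^ (2 * ?n)" by (rule bound) simp
    finally have "measure \<nu> (U r) \<le> (p / r) ^ (2 * ?n)"
      using r0 by (simp only: power_divide pos_le_divide_eq zero_less_power mult.commute)
    also have "\<dots> \<le> (p / r) ^ n" using q by (intro power_decreasing) auto
    finally show False using n by simp
  qed
  \<comment> \<open>Each level r > p gives a null set; the countably many levels p + 1/(k+1) exhaust
    the region where the absolute value exceeds p.\<close>
  have "characters - {\<alpha> \<in> characters. \<bar>\<alpha> b\<bar> \<le> p} \<subseteq> (\<Union>k. U (p + 1 / real (Suc k)))"
  proof
    fix \<alpha> assume \<alpha>: "\<alpha> \<in> characters - {\<alpha> \<in> characters. \<bar>\<alpha> b\<bar> \<le> p}"
    then have "0 < \<bar>\<alpha> b\<bar> - p" by auto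
    then obtain k where "1 / real (Suc k) < \<bar>\<alpha> b\<bar> - p" by (rule nat_approx_posE)
    then show "\<alpha> \<in> (\<Union>k. U (p + 1 / real (Suc k)))"
      using \<alpha> by (auto simp: U_def sp intro!: exI[of _ k])
  qed
  moreover have "(\<Union>k. U (p + 1 / real (Suc k))) \<in> null_sets \<nu>"
    using null U by (intro null_sets_UN null_setsI) (auto simp: emeasure_eq_measure)
  moreover have "characters - {\<alpha> \<in> characters. \<bar>\<alpha> b\<bar> \<le> p} \<in> sets \<nu>"
    using sets.compl_sets[OF radon_measure_closedin_sets[OF \<nu> closed[of p]]] by (simp add: sp)
  ultimately have "characters - {\<alpha> \<in> characters. \<bar>\<alpha> b\<bar> \<le> p} \<in> null_sets \<nu>"
    using null_sets_subset by blast
  then show "emeasure \<nu> (topspace character_topology - {\<alpha> \<in> characters. \<bar>\<alpha> b\<bar> \<le> p}) = 0"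
    by (auto simp: topspace_character_topology)
qed

section \<open>Bounded elements of a locally convex algebra\<close>

text \<open>Cauchy-Schwarz splits L(b^m c^2) into L(b^(2m)) and L(c^4). This moves the exponent from
  2 2^k to 4 2^k and leaves the constant D = sqrt(L(c^4)), which the power bound removes.\<close>

lemma square_positive_bound:
  fixes L :: "'a::{real_algebra_1, comm_ring_1} \<Rightarrow> real"
  assumes L: "square_positive L"
    and bound: "\<And>k. L (b ^ (4 * 2 ^ k)) \<le> r ^ (4 * 2 ^ k)"
  shows "L (b ^ 2 * c ^ 2) \<le> r\<^sup>2 * L (c ^ 2)"
proof (rule square_positive_power_bound[OF L])
  have pos: "\<And>x. 0 \<le> L (x ^ 2)" using L by (auto simp: square_positive_def)
  fix k :: nat
  let ?m = "2 * 2 ^ k :: nat"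
  have m: "4 * 2 ^ k = ?m * 2" by simp
  have "(L (b ^ ?m * c ^ 2))\<^sup>2 \<le> L ((b ^ ?m) ^ 2) * L ((c ^ 2) ^ 2)"
    by (rule square_positive_Cauchy_Schwarz[OF L])
  also have "\<dots> \<le> (r ^ ?m)\<^sup>2 * L ((c ^ 2) ^ 2)"
    using bound[of k] pos[of "c ^ 2"] unfolding m power_mult by (intro mult_right_mono)
  also have "\<dots> = (sqrt (L ((c ^ 2) ^ 2)) * (r\<^sup>2) ^ (2 ^ k))\<^sup>2"
    using pos[of "c ^ 2"] by (simp add: power_mult_distrib power_mult)
  finally show "L (b ^ ?m * c ^ 2) \<le> sqrt (L ((c ^ 2) ^ 2)) * (r\<^sup>2) ^ (2 ^ k)"
    by (rule power2_le_imp_le) (use pos[of "c ^ 2"] in simp)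
qed simp

lemma p_dyadic_bounded_element:
  fixes L :: "'a::{real_algebra_1, comm_ring_1} \<Rightarrow> real"
  assumes L: "square_positive L" and bdd: "bdd_above ((\<lambda>d. p_dyadic L d b) ` {1..})"
  shows "b \<in> bounded_elements L"
proof -
  have pos: "\<And>x. 0 \<le> L (x ^ 2)" using L by (auto simp: square_positive_def)
  obtain r where r: "\<And>d. 1 \<le> d \<Longrightarrow> p_dyadic L d b \<le> r"
    using bdd by (auto simp: bdd_above_def)
  have "L (b ^ (4 * 2 ^ k)) \<le> r ^ (4 * 2 ^ k)" for k
  proof -
    \<comment> \<open>The exponent 4 2^k is the one that occurs in \<open>p_dyadic\<close> at d = k
      + 2.\<close>
    let ?m = "2 ^ (k + 2) :: nat"
    have m: "4 * 2 ^ k = ?m" by simp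
    have 0: "0 \<le> L (b ^ ?m)"
      using pos[of "b ^ (2 ^ (k + 1))"] by (simp add: mult.commute flip: power_mult)
    have "root ?m (L (b ^ ?m)) \<le> r" using r[of "k + 2"] by (simp add: p_dyadic_def)
    then have "root ?m (L (b ^ ?m)) ^ ?m \<le> r ^ ?m" using 0 by (intro power_mono) auto
    then show ?thesis unfolding m using 0 by simp
  qed
  from square_positive_bound[OF L this] show ?thesis
    unfolding bounded_elements_def by (auto intro!: exI[of _ "r\<^sup>2"])
qed

text \<open>For a bounded element the roots are bounded, so the real supremum has its intended
  value. The bound K + 1 is at least 1, which allows K^n to be replaced by (K + 1)^(2n) without
  taking a square root of K.\<close>

lemma p_sup_upper:
  fixes L :: "'a::{real_algebra_1, comm_ring_1} \<Rightarrow> real"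
  assumes L: "square_positive L" and one: "L 1 = 1" and x: "x \<in> bounded_elements L"
  shows "0 \<le> p_sup L x" "\<And>n. 1 \<le> n \<Longrightarrow> L (x ^ (2 * n)) \<le> p_sup L x ^ (2 * n)"
proof -
  have pos: "\<And>x. 0 \<le> L (x ^ 2)" using L by (auto simp: square_positive_def)
  have posn: "0 \<le> L (x ^ (2 * n))" for n
    using pos[of "x ^ n"] by (simp add: mult.commute flip: power_mult)
  obtain K where K: "0 \<le> K" "\<And>c. L (x ^ 2 * c ^ 2) \<le> K * L (c ^ 2)"
    using x by (auto simp: bounded_elements_def)
  have pow: "L (x ^ (2 * n)) \<le> K ^ n" for n
  proof (induction n)
    case (Suc n)
    have "x ^ (2 * Suc n) = x ^ 2 * (x ^ n) ^ 2"
      by (simp only: power_mult[symmetric] power_add[symmetric] mult_Suc_right mult.commute[of n])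
    then have "L (x ^ (2 * Suc n)) = L (x ^ 2 * (x ^ n) ^ 2)" by simp
    also have "\<dots> \<le> K * L ((x ^ n) ^ 2)" by (rule K)
    also have "\<dots> \<le> K * K ^ n"
      using Suc K(1) by (intro mult_left_mono) (simp_all add: mult.commute flip: power_mult)
    finally show ?case by simp
  qed (simp add: one)
  have le: "root (2 * n) (L (x ^ (2 * n))) \<le> K + 1" if "1 \<le> n" for n
  proof -
    have "L (x ^ (2 * n)) \<le> (K + 1) ^ n"
      using pow[of n] power_mono[of K "K + 1" n] K(1) by linarith
    also have "\<dots> \<le> (K + 1) ^ (2 * n)" using K(1) by (intro power_increasing) auto
    finally have "root (2 * n) (L (x ^ (2 * n))) \<le> root (2 * n) ((K + 1) ^ (2 * n))"
      using that by (intro real_root_le_mono) auto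
    then show ?thesis using that K(1) by (simp add: real_root_power_cancel)
  qed
  then have bdd: "bdd_above ((\<lambda>n. root (2 * n) (L (x ^ (2 * n)))) ` {1..})"
    by (intro bdd_aboveI2) auto
  have up: "root (2 * n) (L (x ^ (2 * n))) \<le> p_sup L x" if "1 \<le> n" for n
    unfolding p_sup_def by (rule cSUP_upper[OF _ bdd]) (use that in simp)
  show "0 \<le> p_sup L x"
    using up[of 1] posn[of 1] real_root_ge_zero[of "L (x ^ (2 * 1))" "2 * 1"] by linarith
  fix n :: nat assume n: "1 \<le> n"
  have "root (2 * n) (L (x ^ (2 * n))) ^ (2 * n) \<le> p_sup L x ^ (2 * n)"
    using up[OF n] real_root_ge_zero[OF posn[of n]] by (intro power_mono)
  then show "L (x ^ (2 * n)) \<le> p_sup L x ^ (2 * n)"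
    using n posn[of n] real_root_pow_pos2[of "2 * n" "L (x ^ (2 * n))"] by linarith
qed

text \<open>Membership in \<open>bounded_elements\<close> supplies some constant; here it is
  sharpened to the square of p_L(x), so that p_L(x) < 1 makes multiplication by x a
  contraction.\<close>

lemma p_sup_bound:
  fixes L :: "'a::{real_algebra_1, comm_ring_1} \<Rightarrow> real"
  assumes L: "square_positive L" and one: "L 1 = 1" and x: "x \<in> bounded_elements L"
  shows "L (x ^ 2 * c ^ 2) \<le> (p_sup L x)\<^sup>2 * L (c ^ 2)"
proof (rule square_positive_bound[OF L])
  show "L (x ^ (4 * 2 ^ k)) \<le> p_sup L x ^ (4 * 2 ^ k)" for k
    using p_sup_upper(2)[OF L one x, of "2 * 2 ^ k"] by simp
qed

lemma topspace_locally_convex_algebra: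
  "locally_convex_algebra \<tau> \<Longrightarrow> topspace \<tau> = UNIV"
  unfolding locally_convex_algebra_def seminorm_topology_def
  by (elim conjE exE) (simp add: topology_generated_by_topspace)

text \<open>Along the line through a, each p(t a - d) is Lipschitz in t with constant p a. The lemma
  serves to show that neighbourhoods of 0 absorb every element.\<close>

lemma locally_convex_algebra_continuous_scaleR:
  assumes "locally_convex_algebra \<tau>"
  shows "continuous_map euclideanreal \<tau> (\<lambda>t. t *\<^sub>R a)"
proof -
  obtain P where P: "\<And>p. p \<in> P \<Longrightarrow> seminorm p" "\<tau> = seminorm_topology UNIV P"
    using assms by (auto simp: locally_convex_algebra_def)
  show ?thesis
    unfolding P(2) seminorm_topology_def
  proof (rule continuous_on_generated_topo)
    fix U assume "U \<in> insert UNIV {{x \<in> UNIV. p (x - a) < r} |p a r. p \<in> P \<and> a \<in> UNIV \<and> 0 < r}"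
    then consider "U = UNIV" | p d r where "p \<in> P" "U = {x. p (x - d) < r}" by auto
    then show "openin euclideanreal ((\<lambda>t. t *\<^sub>R a) -` U \<inter> topspace euclideanreal)"
    proof cases
      case 2
      have sn: "seminorm p" using P(1) 2(1) by blast
      have lip: "\<bar>p (s *\<^sub>R a - d) - p (t *\<^sub>R a - d)\<bar> \<le> \<bar>s - t\<bar> * p a" for s t
      proof -
        have *: "p (s *\<^sub>R a - d) \<le> \<bar>s - t\<bar> * p a + p (t *\<^sub>R a - d)" for s t
        proof -
          have "s *\<^sub>R a - d = (s - t) *\<^sub>R a + (t *\<^sub>R a - d)" by (simp add: scaleR_left_diff_distrib)
          then have "p (s *\<^sub>R a - d) \<le> p ((s - t) *\<^sub>R a) + p (t *\<^sub>R a - d)"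
            using sn unfolding seminorm_def by metis
          also have "p ((s - t) *\<^sub>R a) = \<bar>s - t\<bar> * p a" using sn unfolding seminorm_def by blast
          finally show ?thesis .
        qed
        from *[of s t] *[of t s] show ?thesis by (simp add: abs_le_iff abs_minus_commute)
      qed
      have "continuous_on UNIV (\<lambda>t. p (t *\<^sub>R a - d))"
      proof (rule lipschitz_on_continuous_on)
        show "(p a)-lipschitz_on UNIV (\<lambda>t. p (t *\<^sub>R a - d))"
          using lip sn by (intro lipschitz_onI) (auto simp: dist_real_def mult.commute seminorm_def)
      qed
      then have "open {t. p (t *\<^sub>R a - d) < r}"
        by (intro open_Collect_less continuous_on_const)
      then show ?thesis using 2(2) by (simp add: vimage_def)
    qed simp
  qed auto
qed

text \<open>Multiplication is only separately continuous, so \<open>x \<mapsto> L (x\<^sup>2 c\<^sup>2)\<close> need not be continuous;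
  it is bounded through the continuous functional \<open>x \<mapsto> L (x a c\<^sup>2)\<close>.\<close>
lemma dense_bounded_elements_imp_UNIV:
  fixes L :: "'a::{real_algebra_1, comm_ring_1} \<Rightarrow> real"
  assumes lc: "locally_convex_algebra \<tau>" and cont: "continuous_map \<tau> euclideanreal L"
    and L: "square_positive L"
    and dense: "\<tau> closure_of B = topspace \<tau>"
    and V: "openin \<tau> V" "0 \<in> V"
    and bound: "\<And>x c. x \<in> V \<inter> B \<Longrightarrow> L (x ^ 2 * c ^ 2) \<le> L (c ^ 2)"
  shows "bounded_elements L = UNIV"
proof -
  have pos: "\<And>x. 0 \<le> L (x ^ 2)" using L by (auto simp: square_positive_def)
  note top = topspace_locally_convex_algebra[OF lc]
  have inV: "L (a ^ 2 * c ^ 2) \<le> L (c ^ 2)" if a: "a \<in> V" for a c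
  proof -
    define g where "g x = L (x * (a * c ^ 2))" for x
    define s where "s = L (a ^ 2 * c ^ 2)"
    have s: "0 \<le> s" using pos[of "a * c"] by (simp add: s_def power_mult_distrib)
    have "continuous_map \<tau> euclideanreal (L \<circ> (\<lambda>x. x * (a * c ^ 2)))"
      using lc by (intro continuous_map_compose[OF _ cont]) (auto simp: locally_convex_algebra_def)
    then have gc: "continuous_map \<tau> euclideanreal g" by (simp add: o_def g_def[abs_def])
    have ga: "g a = s" by (simp add: g_def s_def power2_eq_square mult.assoc)
    \<comment> \<open>If this failed, continuity of g would give a point x of B in V with g(x)^2 >
      L(c^2) s. Cauchy-Schwarz for x c and a c bounds g(x)^2 by L(x^2 c^2) s, hence by L(c^2) s.
      Only the factor x has moved.\<close>
    have "s\<^sup>2 \<le> L (c ^ 2) * s"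
    proof (rule ccontr)
      assume "\<not> s\<^sup>2 \<le> L (c ^ 2) * s"
      then have lt: "L (c ^ 2) * s < (g a)\<^sup>2" by (simp add: ga)
      have "openin \<tau> {x \<in> topspace \<tau>. g x \<in> {t. L (c ^ 2) * s < t\<^sup>2}}"
        by (rule openin_continuous_map_preimage[OF gc])
          (simp, intro open_Collect_less continuous_intros)
      then have 1: "openin \<tau> (V \<inter> {x. L (c ^ 2) * s < (g x)\<^sup>2})"
        using V(1) by (simp add: top openin_Int)
      have 2: "a \<in> V \<inter> {x. L (c ^ 2) * s < (g x)\<^sup>2}" using a lt by simp
      have "a \<in> \<tau> closure_of B" by (simp add: dense top)
      then have "\<exists>x. x \<in> B \<and> x \<in> V \<inter> {x. L (c ^ 2) * s < (g x)\<^sup>2}"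
        using 1 2 by (simp only: in_closure_of)
      then obtain x where x: "x \<in> B" "x \<in> V" "L (c ^ 2) * s < (g x)\<^sup>2" by auto
      have "(g x)\<^sup>2 = (L ((x * c) * (a * c)))\<^sup>2"
        by (simp add: g_def power2_eq_square[of c] ac_simps)
      also have "\<dots> \<le> L ((x * c) ^ 2) * L ((a * c) ^ 2)"
        by (rule square_positive_Cauchy_Schwarz[OF L])
      also have "\<dots> = L (x ^ 2 * c ^ 2) * s" by (simp add: s_def power_mult_distrib)
      also have "\<dots> \<le> L (c ^ 2) * s" using bound[of x c] x s by (intro mult_right_mono) auto
      finally show False using x(3) by simp
    qed
    then show ?thesis
      using s pos[of c] unfolding s_def[symmetric]
      by (cases "s = 0") (auto simp: power2_eq_square)
  qed
  have "a \<in> bounded_elements L" for a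
  proof -
    have "openin euclideanreal {t \<in> topspace euclideanreal. t *\<^sub>R a \<in> V}"
      using locally_convex_algebra_continuous_scaleR[OF lc] V(1) by (rule openin_continuous_map_preimage)
    then have "open {t. t *\<^sub>R a \<in> V}" by simp
    moreover have "0 \<in> {t. t *\<^sub>R a \<in> V}" using V(2) by simp
    ultimately obtain e where e: "0 < e" "ball 0 e \<subseteq> {t. t *\<^sub>R a \<in> V}"
      by (meson open_contains_ball)
    \<comment> \<open>A small multiple of a lies in V and is bounded with constant 1; the bounded
      elements form a subspace, so a itself is recovered by rescaling.\<close>
    then have "(e / 2) *\<^sub>R a \<in> V" by (auto simp: subset_iff)
    then have "(e / 2) *\<^sub>R a \<in> bounded_elements L"
      using inV unfolding bounded_elements_def by (auto intro!: exI[of _ 1])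
    moreover have "subspace (bounded_elements L)"
      using bounded_elements_subalgebra[OF L] by (simp add: unital_subalgebra_def)
    ultimately have "(2 / e) *\<^sub>R ((e / 2) *\<^sub>R a) \<in> bounded_elements L"
      by (rule subspace_scale[rotated])
    then show ?thesis using e(1) by simp
  qed
  then show ?thesis by blast
qed

theorem corollary4p7:
  fixes \<tau> :: "'a::{real_algebra_1, comm_ring_1} topology"
    and L :: "'a \<Rightarrow> real"
    and B :: "'a set"
    and I :: "'i set"
    and b :: "'i \<Rightarrow> 'a"
  assumes "(characters :: ('a \<Rightarrow> real) set) \<noteq> {}"
    and "locally_convex_algebra \<tau>"
    and "linear L"
    and "continuous_map \<tau> euclideanreal L"
    and "\<And>a. 0 \<le> L (a ^ 2)"
    and "L 1 = 1"
    and "B = unital_subalgebra hull (b ` I)"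
    and "\<tau> closure_of B = topspace \<tau>"
    and "\<And>i. i \<in> I \<Longrightarrow> bdd_above ((\<lambda>d. p_dyadic L d (b i)) ` {1..})"
    and "\<And>U. openin (seminorm_topology B {p_sup L}) U \<Longrightarrow> openin (subtopology \<tau> B) U"
  shows "(\<exists>!\<nu>. radon_measure character_topology \<nu> \<and> represents \<nu> L \<and>
               compactin character_topology (support character_topology \<nu>)) \<and>
         (\<forall>\<nu>. radon_measure character_topology \<nu> \<and> represents \<nu> L \<and>
               compactin character_topology (support character_topology \<nu>) \<longrightarrow>
               support character_topology \<nu> \<subseteq>
                 {\<alpha> \<in> characters. \<forall>i\<in>I. \<bar>\<alpha> (b i)\<bar> \<le> p_sup L (b i)})"
proof -
  have L: "square_positive L" using assms(3,5) by (simp add: square_positive_def)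
  note one = \<open>L 1 = 1\<close>
  have b: "b i \<in> bounded_elements L" if "i \<in> I" for i
    using p_dyadic_bounded_element[OF L assms(9)[OF that]] .
  then have B: "B \<subseteq> bounded_elements L"
    unfolding assms(7) by (intro hull_minimal bounded_elements_subalgebra[OF L]) auto
  have "0 \<in> B"
    unfolding assms(7) hull_def by (auto simp: unital_subalgebra_def subspace_0)
  have "L 0 = 0" using assms(3) by (rule linear_0)
  \<comment> \<open>The supremum runs over n >= 1, so every power of 0 involved is 0.\<close>
  then have "p_sup L 0 = (SUP n\<in>{1::nat..}. 0)"
    unfolding p_sup_def by (intro SUP_cong) (auto simp: power_0_left)
  then have p0: "p_sup L 0 = 0" by simp
  \<comment> \<open>The comparison of topologies is used for the open unit ball of p_L in B: it is
    the trace on B of a \<tau>-open set V, on which \<open>p_sup_bound\<close> gives the constant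
    1.\<close>
  have "openin (seminorm_topology B {p_sup L}) {x \<in> B. p_sup L (x - 0) < 1}"
    unfolding seminorm_topology_def
    by (rule topology_generated_by_Basis, rule insertI2)
      (use \<open>0 \<in> B\<close> in \<open>auto intro!: exI[of _ "p_sup L"] exI[of _ "0 :: 'a"] exI[of _ "1 :: real"]\<close>)
  then have "openin (subtopology \<tau> B) {x \<in> B. p_sup L x < 1}"
    using assms(10) by simp
  then obtain V where V: "openin \<tau> V" "{x \<in> B. p_sup L x < 1} = V \<inter> B"
    by (auto simp: openin_subtopology)
  have "L (x ^ 2 * c ^ 2) \<le> L (c ^ 2)" if "x \<in> V \<inter> B" for x c
  proof -
    have x: "x \<in> B" "p_sup L x < 1" using that V(2) by auto
    have xb: "x \<in> bounded_elements L" using x B by blast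
    have "L (x ^ 2 * c ^ 2) \<le> (p_sup L x)\<^sup>2 * L (c ^ 2)" by (rule p_sup_bound[OF L one xb])
    also have "\<dots> \<le> 1 * L (c ^ 2)"
      using x(2) p_sup_upper(1)[OF L one xb] assms(5)
      by (intro mult_right_mono) (auto simp: power_le_one)
    finally show ?thesis by simp
  qed
  moreover have "0 \<in> V \<inter> B"
    unfolding V(2)[symmetric] using \<open>0 \<in> B\<close> p0 by simp
  ultimately have "bounded_elements L = UNIV"
    using dense_bounded_elements_imp_UNIV[OF assms(2,4) L assms(8) V(1)] by blast
  then have "\<exists>\<nu>. radon_measure character_topology \<nu> \<and> represents \<nu> L \<and>
      compactin character_topology (support character_topology \<nu>)"
    by (rule exists_representing_measure[OF L one])
  moreover have "support character_topology \<nu> \<subseteq>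
      {\<alpha> \<in> characters. \<forall>i\<in>I. \<bar>\<alpha> (b i)\<bar> \<le> p_sup L (b i)}"
    if \<nu>: "radon_measure character_topology \<nu>" "represents \<nu> L" for \<nu>
  proof -
    have "support character_topology \<nu> \<subseteq> characters"
      using closedin_subset[OF closedin_support[OF \<nu>(1)]] by (simp add: topspace_character_topology)
    moreover have "support character_topology \<nu> \<subseteq> {\<alpha> \<in> characters. \<bar>\<alpha> (b i)\<bar> \<le> p_sup L (b i)}"
      if "i \<in> I" for i
      using p_sup_upper[OF L one b[OF that]] by (intro support_representing_measure[OF \<nu> one])
    ultimately show ?thesis by blast
  qed
  ultimately show ?thesis
    using representing_measure_unique[of L, OF one] by blast
qed

end
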